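(* Let $P,Q\subset\mathbb{R}^3$ each be either an equiprojective polytope, a polygon, or a line segment, and assume $P+Q$ is $3$-dimensional. Then the Minkowski sum $P+Q$ is equiprojective if and only if, for each edge direction $u$ shared by $P$ and $Q$, either (i) $C_P(u)=u^\perp$ or $C_Q(u)=u^\perp$, or (ii) $C_P(u)=C_Q(u)$ or $C_P(u)=-C_Q(u)$.
   Context: A $3$-dimensional polytope $P\subset\mathbb{R}^3$ is $k$-equiprojective when its orthogonal projection onto any plane not orthogonal to a facet of $P$ is a polygon with exactly $k$ vertices; equiprojective means $k$-equiprojective for some $k$. For a polytope $P\subset\mathbb{R}^3$ (of any dimension) and a face $F$, $N_P(F)=\{u\in\mathbb{R}^3:\ u\cdot x\le u\cdot y\ \forall x\in P, y\in F\}$. For non-zero $u$, the aggregated cone $C_P(u)$ is the union of the $2$-dimensional normal cones of $P$ contained in the plane $u^\perp$. A vector $u\in\mathbb{S}^2$ is an edge direction of $P$ when its first non-zero coordinate is positive and some edge of $P$ has difference of vertices a multiple of $u$. *)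

theory Defs
  imports "HOL-Analysis.Analysis"
begin

type_synonym R3 = "real ^ 3"

definition proj_plane :: "R3 \<Rightarrow> R3 \<Rightarrow> R3" where
  "proj_plane u x = x - ((x \<bullet> u) / (u \<bullet> u)) *\<^sub>R u"

text \<open>The plane with normal u is orthogonal to the plane of the facet F
  iff u is parallel to F, i.e. u lies in the linear span of the differences of points of F.\<close>
definition plane_orth_to_facet :: "R3 \<Rightarrow> R3 set \<Rightarrow> bool" where
  "plane_orth_to_facet u F \<longleftrightarrow> u \<in> span {x - y | x y. x \<in> F \<and> y \<in> F}"

definition k_equiprojective :: "nat \<Rightarrow> R3 set \<Rightarrow> bool" where
  "k_equiprojective k P \<longleftrightarrow> polytope P \<and> aff_dim P = 3 \<and>
     (\<forall>u. u \<noteq> 0 \<and> (\<forall>F. F facet_of P \<longrightarrow> \<not> plane_orth_to_facet u F) \<longrightarrow>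
        polytope (proj_plane u ` P) \<and> aff_dim (proj_plane u ` P) = 2 \<and>
        card {v. v extreme_point_of (proj_plane u ` P)} = k)"

definition equiprojective :: "R3 set \<Rightarrow> bool" where
  "equiprojective P \<longleftrightarrow> (\<exists>k. k_equiprojective k P)"

definition minkowski_sum :: "R3 set \<Rightarrow> R3 set \<Rightarrow> R3 set" where
  "minkowski_sum P Q = {x + y | x y. x \<in> P \<and> y \<in> Q}"

definition normal_cone :: "R3 set \<Rightarrow> R3 set \<Rightarrow> R3 set" where
  "normal_cone P F = {u. \<forall>x\<in>P. \<forall>y\<in>F. u \<bullet> x \<le> u \<bullet> y}"

definition orth_plane :: "R3 \<Rightarrow> R3 set" where
  "orth_plane u = {x. u \<bullet> x = 0}"

definition aggregated_cone :: "R3 set \<Rightarrow> R3 \<Rightarrow> R3 set" where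
  "aggregated_cone P u = \<Union>{normal_cone P F | F. F face_of P \<and> F \<noteq> {} \<and>
       aff_dim (normal_cone P F) = 2 \<and> normal_cone P F \<subseteq> orth_plane u}"

definition first_nonzero_pos :: "R3 \<Rightarrow> bool" where
  "first_nonzero_pos u \<longleftrightarrow> u $ 1 > 0 \<or> (u $ 1 = 0 \<and> u $ 2 > 0) \<or>
     (u $ 1 = 0 \<and> u $ 2 = 0 \<and> u $ 3 > 0)"

definition edge_direction :: "R3 set \<Rightarrow> R3 \<Rightarrow> bool" where
  "edge_direction P u \<longleftrightarrow> norm u = 1 \<and> first_nonzero_pos u \<and>
     (\<exists>E a b. E edge_of P \<and> a extreme_point_of E \<and> b extreme_point_of E \<and> a \<noteq> b \<and>
        (\<exists>c. a - b = c *\<^sub>R u))"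

definition admissible_summand :: "R3 set \<Rightarrow> bool" where
  "admissible_summand P \<longleftrightarrow> equiprojective P \<or> (polytope P \<and> aff_dim P = 2) \<or>
     (polytope P \<and> aff_dim P = 1)"

end

theory Submission
  imports Defs
begin

text \<open>
  For \<open>w\<close> not parallel to a facet of \<open>R\<close>, the vertices of the projection of \<open>R\<close> along \<open>w\<close> are counted by
  its edges, that is, by the unit vectors \<open>d \<bottom> w\<close> that are maximised over \<open>R\<close> at more than one point.
  Such a \<open>d\<close> is normal to an edge of some direction \<open>u\<close>, and then \<open>d\<close> is one of the two unit vectors
  \<open>\<plusminus>m\<close> orthogonal to \<open>u\<close> and \<open>w\<close>. So the number of vertices is the sum over \<open>u\<close> of
  \<open>g\<^sub>u(m) = [m \<in> C(u)] + [-m \<in> C(u)]\<close>, and it is constant as soon as every \<open>g\<^sub>u\<close> is constant on generic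
  vectors of the plane orthogonal to \<open>u\<close>.

  Conversely, if the number of vertices is constant, add the counts at \<open>w = u\<^sub>0 + s v\<close> and
  \<open>w = u\<^sub>0 - s v\<close> for small \<open>s\<close>. Both choices give the same term \<open>g\<^sub>u\<close> for \<open>u = u\<^sub>0\<close>, while the other terms
  jump only across a plane through \<open>u\<^sub>0\<close>, so that their contributions to the sum do not depend on \<open>v\<close>. Hence
  \<open>g\<^sub>u\<close> is constant for \<open>u = u\<^sub>0\<close>. For polygons and line segments this is immediate.

  The face of \<open>P + Q\<close> maximising \<open>d\<close> is the sum of the corresponding faces of \<open>P\<close> and \<open>Q\<close>, so up to
  finitely many rays the cone of \<open>P + Q\<close> at \<open>u\<close> is the union of those of \<open>P\<close> and \<open>Q\<close>. It remains to see
  when the union of two such cones, for each of which \<open>g\<^sub>u\<close> is constantly 1 or 2, again has constant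
  \<open>g\<^sub>u\<close>; as the cones are closed and regular, generic vectors determine them.
\<close>

subsection \<open>Faces maximising a linear functional\<close>

text \<open>Indexing faces by an outer normal makes them add up under Minkowski sums and lets the
  normal vary continuously.\<close>

definition support_face :: "R3 set \<Rightarrow> R3 \<Rightarrow> R3 set" where
  "support_face P d = {x \<in> P. \<forall>y\<in>P. d \<bullet> y \<le> d \<bullet> x}"

text \<open>A two-dimensional face contains segments in many directions, so this detects edges of
  direction \<open>u\<close> only at collinear faces.\<close>

definition has_segment :: "R3 set \<Rightarrow> R3 \<Rightarrow> bool" where
  "has_segment S u \<longleftrightarrow> (\<exists>x\<in>S. \<exists>y\<in>S. x \<noteq> y \<and> (\<exists>c. x - y = c *\<^sub>R u))"

text \<open>Both signs enter because \<open>segment_count\<close> looks at \<open>d\<close> and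
  \<open>- d\<close> together. A non-zero vector fails to be generic when one of the two faces has
  dimension at least two, for instance at the normal of a facet or of a polygon.\<close>

definition generic_dir :: "R3 set \<Rightarrow> R3 \<Rightarrow> bool" where
  "generic_dir P d \<longleftrightarrow> d \<noteq> 0 \<and> collinear (support_face P d) \<and> collinear (support_face P (- d))"

lemma generic_dir_minus: "generic_dir P d \<Longrightarrow> generic_dir P (- d)"
  by (simp add: generic_dir_def)

lemma parallel_if_cross_eq_0:
  fixes x y :: R3
  assumes "cross3 x y = 0" "y \<noteq> 0"
  shows "\<exists>c. x = c *\<^sub>R y"
proof -
  have "cross3 y (cross3 x y) = (y \<bullet> y) *\<^sub>R x - (y \<bullet> x) *\<^sub>R y"
    by (rule Lagrange)
  then have "(y \<bullet> y) *\<^sub>R x = (y \<bullet> x) *\<^sub>R y" using assms by simp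
  then have "(1 / (y \<bullet> y)) *\<^sub>R (y \<bullet> y) *\<^sub>R x = (1 / (y \<bullet> y)) *\<^sub>R (y \<bullet> x) *\<^sub>R y" by simp
  then have "x = ((y \<bullet> x) / (y \<bullet> y)) *\<^sub>R y" using assms(2) by simp
  then show ?thesis by blast
qed

lemma orthogonal_to_two_parallel_cross:
  fixes a b d :: R3
  assumes "d \<bullet> a = 0" "d \<bullet> b = 0" "cross3 a b \<noteq> 0"
  shows "\<exists>c. d = c *\<^sub>R cross3 a b"
proof (rule parallel_if_cross_eq_0)
  show "cross3 d (cross3 a b) = 0" using assms by (simp add: Lagrange)
qed fact

lemma support_face_subset: "support_face P d \<subseteq> P"
  by (auto simp: support_face_def)

lemma support_face_inner_eq:
  "x \<in> support_face P d \<Longrightarrow> y \<in> support_face P d \<Longrightarrow> d \<bullet> x = d \<bullet> y"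
  by (force simp: support_face_def intro: order_antisym)

lemma support_face_nonempty:
  assumes "polytope P" "P \<noteq> {}"
  shows "support_face P d \<noteq> {}"
proof -
  have "continuous_on P (\<lambda>x. d \<bullet> x)" by (intro continuous_intros)
  from continuous_attains_sup[OF polytope_imp_compact[OF assms(1)] assms(2) this]
  show ?thesis by (auto simp: support_face_def)
qed

lemma support_face_face_of:
  assumes "convex P"
  shows "support_face P d face_of P"
proof (cases "support_face P d = {}")
  case False
  then obtain x where x: "x \<in> P" "\<forall>y\<in>P. d \<bullet> y \<le> d \<bullet> x" by (auto simp: support_face_def)
  have "support_face P d = P \<inter> {y. d \<bullet> y = d \<bullet> x}"
    using x by (auto simp: support_face_def intro: order_antisym)
  then show ?thesis
    using face_of_Int_supporting_hyperplane_le[OF assms, of d "d \<bullet> x"] x by simp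
qed simp

lemma polytope_support_face: "polytope P \<Longrightarrow> polytope (support_face P d)"
  using face_of_polytope_polytope support_face_face_of polytope_imp_convex by blast

lemma support_face_scaleR: "c > 0 \<Longrightarrow> support_face P (c *\<^sub>R d) = support_face P d"
  by (auto simp: support_face_def)

lemma support_face_add_const:
  assumes "\<And>x y. x \<in> G \<Longrightarrow> y \<in> G \<Longrightarrow> e \<bullet> x = e \<bullet> y"
  shows "support_face G (a *\<^sub>R e + y) = support_face G y"
proof -
  have "(a *\<^sub>R e + y) \<bullet> z \<le> (a *\<^sub>R e + y) \<bullet> x \<longleftrightarrow> y \<bullet> z \<le> y \<bullet> x" if "x \<in> G" "z \<in> G" for x z
    using assms[OF that] by (simp add: inner_add_left)
  then show ?thesis by (auto simp: support_face_def)
qed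

lemma support_face_const:
  assumes "\<And>x y. x \<in> G \<Longrightarrow> y \<in> G \<Longrightarrow> e \<bullet> x = e \<bullet> y"
  shows "support_face G e = G"
proof -
  have "e \<bullet> y \<le> e \<bullet> x" if "x \<in> G" "y \<in> G" for x y using assms[OF that] by simp
  then show ?thesis by (auto simp: support_face_def)
qed

text \<open>Varying one summand while the other is fixed shows that both parts of a maximal sum are
  maximal; adding the two inequalities gives the converse.\<close>

lemma support_face_minkowski_sum:
  "support_face (minkowski_sum P Q) d = minkowski_sum (support_face P d) (support_face Q d)"
proof (intro equalityI subsetI)
  fix z assume "z \<in> support_face (minkowski_sum P Q) d"
  then obtain x y where z: "z = x + y" "x \<in> P" "y \<in> Q"
    and m: "\<And>x' y'. x' \<in> P \<Longrightarrow> y' \<in> Q \<Longrightarrow> d \<bullet> (x' + y') \<le> d \<bullet> (x + y)"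
    unfolding support_face_def minkowski_sum_def by blast
  have "x \<in> support_face P d" using m[OF _ z(3)] z by (simp add: support_face_def inner_add_right)
  moreover have "y \<in> support_face Q d" using m[OF z(2)] z by (simp add: support_face_def inner_add_right)
  ultimately show "z \<in> minkowski_sum (support_face P d) (support_face Q d)"
    using z by (auto simp: minkowski_sum_def)
next
  fix z assume "z \<in> minkowski_sum (support_face P d) (support_face Q d)"
  then obtain x y where z: "z = x + y" "x \<in> support_face P d" "y \<in> support_face Q d"
    by (auto simp: minkowski_sum_def)
  have "d \<bullet> (x' + y') \<le> d \<bullet> (x + y)" if "x' \<in> P" "y' \<in> Q" for x' y'
    using z that by (simp add: support_face_def inner_add_right add_mono)
  then show "z \<in> support_face (minkowski_sum P Q) d"
    using z unfolding support_face_def minkowski_sum_def by fastforce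
qed

section \<open>Normal cones and perturbation of the direction\<close>

lemma normal_cone_iff: "F \<subseteq> P \<Longrightarrow> d \<in> normal_cone P F \<longleftrightarrow> F \<subseteq> support_face P d"
  by (auto simp: normal_cone_def support_face_def)

lemma normal_cone_eq_Inter:
  "normal_cone P F = (\<Inter>x\<in>P. \<Inter>y\<in>F. {u. (x - y) \<bullet> u \<le> 0})"
  by (auto simp: normal_cone_def algebra_simps inner_commute)

lemma closed_normal_cone: "closed (normal_cone P F)"
  unfolding normal_cone_eq_Inter by (intro closed_INT ballI closed_halfspace_le)

lemma convex_normal_cone: "convex (normal_cone P F)"
  unfolding normal_cone_eq_Inter by (intro convex_INT convex_halfspace_le)

text \<open>Only finitely many faces have a normal cone missing \<open>d\<close>, and these cones
  are closed. A vector \<open>e\<close> near \<open>d\<close> avoids them all but lies in the normal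
  cone of its own face, so that cone contains \<open>d\<close>.\<close>

lemma eventually_support_face_subset:
  assumes "polytope P"
  shows "\<forall>\<^sub>F e in nhds d. support_face P e \<subseteq> support_face P d"
proof -
  define C where "C = \<Union>(normal_cone P ` {F. F face_of P \<and> d \<notin> normal_cone P F})"
  have fin: "finite {F. F face_of P \<and> d \<notin> normal_cone P F}"
    using finite_polytope_faces[OF assms] by simp
  have "open (- C)" unfolding C_def open_Compl
    by (intro open_Compl closed_UN fin closed_normal_cone ballI)
  moreover have "d \<in> - C" by (auto simp: C_def)
  ultimately have "\<forall>\<^sub>F e in nhds d. e \<in> - C" by (rule eventually_nhds_in_open)
  then show ?thesis
  proof eventually_elim
    case (elim e)
    have F: "support_face P e face_of P" by (intro support_face_face_of polytope_imp_convex assms)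
    have "e \<in> normal_cone P (support_face P e)" by (simp add: normal_cone_iff support_face_subset)
    then have "d \<in> normal_cone P (support_face P e)" using elim F by (auto simp: C_def)
    then show ?case by (simp add: normal_cone_iff support_face_subset)
  qed
qed

text \<open>On the face of \<open>m\<close> the functional \<open>m\<close> is constant, so
  \<open>m + s y\<close> orders its points as \<open>y\<close> does. The assumed inclusion places
  all maximisers over \<open>P\<close> in that face.\<close>

lemma support_face_perturb:
  assumes "support_face P (m + s *\<^sub>R y) \<subseteq> support_face P m" "support_face P (m + s *\<^sub>R y) \<noteq> {}" "s > 0"
  shows "support_face P (m + s *\<^sub>R y) = support_face (support_face P m) y"
proof (intro equalityI subsetI)
  fix x assume x: "x \<in> support_face P (m + s *\<^sub>R y)"
  have xm: "x \<in> support_face P m" using assms x by blast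
  have "y \<bullet> z \<le> y \<bullet> x" if z: "z \<in> support_face P m" for z
  proof -
    have "(m + s *\<^sub>R y) \<bullet> z \<le> (m + s *\<^sub>R y) \<bullet> x"
      using x z by (auto simp: support_face_def)
    then show ?thesis using support_face_inner_eq[OF xm z] assms(3) by (simp add: inner_add_left)
  qed
  then show "x \<in> support_face (support_face P m) y"
    using xm by (auto simp: support_face_def[of "support_face P m"])
next
  fix x assume x: "x \<in> support_face (support_face P m) y"
  then have xm: "x \<in> support_face P m" using support_face_subset by blast
  \<comment> \<open>A maximiser over the whole of \<open>P\<close>. It lies in the face of
    \<open>m\<close>, where \<open>x\<close> does at least as well, so \<open>x\<close> is a
    maximiser too.\<close>
  obtain z where z: "z \<in> support_face P (m + s *\<^sub>R y)" using assms by blast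
  then have zm: "z \<in> support_face P m" using assms by blast
  have "y \<bullet> z \<le> y \<bullet> x" using x zm by (auto simp: support_face_def[of "support_face P m"])
  then have "(m + s *\<^sub>R y) \<bullet> z \<le> (m + s *\<^sub>R y) \<bullet> x"
    using support_face_inner_eq[OF xm zm] assms(3) by (simp add: inner_add_left)
  then have "(m + s *\<^sub>R y) \<bullet> p \<le> (m + s *\<^sub>R y) \<bullet> x" if "p \<in> P" for p
    using z that by (force simp: support_face_def)
  then show "x \<in> support_face P (m + s *\<^sub>R y)"
    using xm by (auto simp: support_face_def)
qed

lemma eventually_support_face_perturb:
  assumes "polytope P" "P \<noteq> {}"
  shows "\<forall>\<^sub>F s in at_right 0. support_face P (m + s *\<^sub>R y) = support_face (support_face P m) y"
proof -
  have "((\<lambda>s::real. m + s *\<^sub>R y) \<longlongrightarrow> m + 0 *\<^sub>R y) (at_right 0)"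
    by (intro tendsto_intros)
  then have "filterlim (\<lambda>s::real. m + s *\<^sub>R y) (nhds m) (at_right 0)" by simp
  from eventually_compose_filterlim[OF eventually_support_face_subset[OF assms(1)] this]
  have "\<forall>\<^sub>F s in at_right 0. support_face P (m + s *\<^sub>R y) \<subseteq> support_face P m" .
  moreover have "\<forall>\<^sub>F s in at_right (0::real). s > 0" by (simp add: eventually_at_right_less)
  ultimately show ?thesis
    by eventually_elim (intro support_face_perturb support_face_nonempty assms)
qed

section \<open>Collinear faces and generic directions\<close>

lemma collinear_has_segment:
  assumes "collinear S" "has_segment S u" "x \<in> S" "y \<in> S"
  shows "\<exists>c. x - y = c *\<^sub>R u"
proof -
  obtain a b c where ab: "a \<in> S" "b \<in> S" "a \<noteq> b" "a - b = c *\<^sub>R u"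
    using assms(2) by (auto simp: has_segment_def)
  obtain e where e: "\<And>x y. x \<in> S \<Longrightarrow> y \<in> S \<Longrightarrow> \<exists>c. x - y = c *\<^sub>R e"
    using assms(1) by (auto simp: collinear_def)
  obtain s where s: "a - b = s *\<^sub>R e" using e ab by blast
  obtain t where t: "x - y = t *\<^sub>R e" using e assms by blast
  have "s \<noteq> 0" using s ab by auto
  then have "x - y = (t / s) *\<^sub>R (a - b)" using s t by simp
  then show ?thesis using ab by auto
qed

text \<open>If all these cross products vanished for a fixed pair \<open>x \<noteq> y\<close>, every
  difference of points of \<open>S\<close> would be a multiple of \<open>x - y\<close>.\<close>

lemma not_collinear_obtain:
  fixes S :: "R3 set"
  assumes "\<not> collinear S"
  obtains x y z where "x \<in> S" "y \<in> S" "z \<in> S" "cross3 (x - y) (x - z) \<noteq> 0"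
proof -
  obtain x y where xy: "x \<in> S" "y \<in> S" "x \<noteq> y"
    using assms by (metis collinear_def eq_iff_diff_eq_0 scaleR_zero_left)
  obtain a b where ab: "a \<in> S" "b \<in> S" "\<nexists>c. a - b = c *\<^sub>R (x - y)"
    using assms unfolding collinear_def by blast
  have "\<exists>z\<in>S. cross3 (x - y) (x - z) \<noteq> 0"
  proof (rule ccontr)
    assume "\<not> ?thesis"
    then have z: "cross3 (x - y) (x - a) = 0" "cross3 (x - y) (x - b) = 0" using ab by auto
    have "cross3 (a - b) (x - y) = cross3 (x - y) (x - a) - cross3 (x - y) (x - b)"
      by (simp add: cross3_simps)
    then have "cross3 (a - b) (x - y) = 0" using z by simp
    with parallel_if_cross_eq_0[OF this] ab xy show False by auto
  qed
  then show ?thesis using that xy by blast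
qed

text \<open>A non-collinear face has two independent difference vectors, and each of its normals is
  a multiple of their cross product. Hence each of the finitely many faces accounts for at most one
  line.\<close>

lemma finite_nongeneric_lines:
  assumes "polytope P"
  shows "\<exists>B. finite B \<and> (\<forall>d. d \<noteq> 0 \<and> \<not> generic_dir P d \<longrightarrow> (\<exists>b\<in>B. \<exists>c. d = c *\<^sub>R b))"
proof -
  have "\<exists>b. \<forall>d. support_face P d = F \<longrightarrow> (\<exists>c. d = c *\<^sub>R b)" if nc: "\<not> collinear F" for F
  proof -
    obtain x y z where F: "x \<in> F" "y \<in> F" "z \<in> F" "cross3 (x - y) (x - z) \<noteq> 0"
      using not_collinear_obtain[OF nc] by metis
    show ?thesis
    proof (intro exI[of _ "cross3 (x - y) (x - z)"] allI impI)
      fix d assume "support_face P d = F"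
      then have "d \<bullet> x = d \<bullet> y" "d \<bullet> x = d \<bullet> z" using support_face_inner_eq F by blast+
      then show "\<exists>c. d = c *\<^sub>R cross3 (x - y) (x - z)"
        by (intro orthogonal_to_two_parallel_cross F) (simp_all add: inner_diff_right)
    qed
  qed
  then obtain b where b: "\<And>F d. \<not> collinear F \<Longrightarrow> support_face P d = F \<Longrightarrow> \<exists>c. d = c *\<^sub>R b F"
    by metis
  show ?thesis
  proof (intro exI conjI allI impI)
    show "finite (b ` {F. F face_of P})" using finite_polytope_faces[OF assms] by simp
    fix d assume d: "d \<noteq> 0 \<and> \<not> generic_dir P d"
    have f: "support_face P e \<in> {F. F face_of P}" for e
      by (simp add: support_face_face_of polytope_imp_convex assms)
    consider "\<not> collinear (support_face P d)" | "\<not> collinear (support_face P (- d))"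
      using d by (auto simp: generic_dir_def)
    then show "\<exists>b\<in>b ` {F. F face_of P}. \<exists>c. d = c *\<^sub>R b"
    proof cases
      case 1
      then show ?thesis using b[OF 1 refl] f by blast
    next
      case 2
      then obtain c where "- d = c *\<^sub>R b (support_face P (- d))" using b[OF 2 refl] by blast
      then have "d = (- c) *\<^sub>R b (support_face P (- d))" by (metis minus_minus scaleR_minus_left)
      then show ?thesis using f by blast
    qed
  qed
qed

text \<open>The segment from \<open>x\<close> towards an independent \<open>z\<close> lies on a line
  missing the origin. It meets each line through the origin at most once, so points close to
  \<open>x\<close> on it avoid all the lines of \<open>B\<close>.\<close>

lemma closure_minus_lines:
  fixes x z :: R3
  assumes "convex N" "x \<in> N" "z \<in> N" "cross3 x z \<noteq> 0" "finite B"
  shows "x \<in> closure {y \<in> N. y \<noteq> 0 \<and> (\<forall>b\<in>B. \<nexists>c. y = c *\<^sub>R b)}" (is "x \<in> closure ?G")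
proof -
  define p where "p t = x + t *\<^sub>R (z - x)" for t :: real
  have xz: "cross3 (p s) (p t) = (t - s) *\<^sub>R cross3 x z" for s t
    by (simp add: p_def cross3_simps)
  have one: "finite {t. \<exists>c. p t = c *\<^sub>R b}" for b
  proof -
    have "s = t" if "\<exists>c. p s = c *\<^sub>R b" "\<exists>c. p t = c *\<^sub>R b" for s t
    proof -
      have "cross3 (p s) (p t) = 0" using that by (auto simp: cross_mult_left cross_mult_right)
      then show ?thesis using xz assms(4) by simp
    qed
    then have "\<exists>a. {t. \<exists>c. p t = c *\<^sub>R b} \<subseteq> {a}" by blast
    then show ?thesis using finite_subset by blast
  qed
  \<comment> \<open>The inserted \<open>0\<close> stands for the condition
    \<open>p t = 0\<close>.\<close>
  have fin: "finite (\<Union>b\<in>insert 0 B. {t. \<exists>c. p t = c *\<^sub>R b})" (is "finite ?T")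
    using one assms(5) by blast
  have "\<forall>\<^sub>F t in at_right (0::real). \<forall>a\<in>?T. t \<noteq> a"
    by (intro eventually_ball_finite fin ballI eventually_neq_at_within)
  moreover have "\<forall>\<^sub>F t in at_right (0::real). 0 < t \<and> t < 1"
    using eventually_at_right_real[of 0 1] by simp
  ultimately have "\<forall>\<^sub>F t in at_right 0. p t \<in> ?G"
  proof eventually_elim
    case (elim t)
    have "p t = (1 - t) *\<^sub>R x + t *\<^sub>R z" by (simp add: p_def algebra_simps)
    then have "p t \<in> N" using convexD_alt[OF assms(1-3)] elim by simp
    moreover have "p t \<noteq> 0" using elim by auto
    ultimately show ?case using elim by blast
  qed
  then have "\<forall>\<^sub>F t in at_right 0. p t \<in> closure ?G"
    by eventually_elim (rule subsetD[OF closure_subset])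
  moreover have "(p \<longlongrightarrow> x + 0 *\<^sub>R (z - x)) (at_right 0)"
    unfolding p_def by (intro tendsto_intros)
  ultimately show ?thesis
    using Lim_in_closed_set[OF closed_closure, of p ?G "at_right 0" x] by simp
qed

subsection \<open>Vertices and edges of a polygon\<close>

lemma orthogonal_cross_nonzero:
  fixes w d :: R3
  assumes "d \<bullet> w = 0" "d \<noteq> 0" "w \<noteq> 0"
  shows "cross3 w d \<noteq> 0"
proof
  assume "cross3 w d = 0"
  then have "(norm w * norm d)\<^sup>2 = 0" using norm_cross_dot[of w d] assms(1) by (simp add: inner_commute)
  then show False using assms by simp
qed

lemma orthogonal_basis_zero:
  fixes w d z :: R3
  assumes "d \<bullet> w = 0" "d \<noteq> 0" "w \<noteq> 0" "z \<bullet> w = 0" "z \<bullet> d = 0" "z \<bullet> cross3 w d = 0"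
  shows "z = 0"
proof -
  obtain c where "z = c *\<^sub>R cross3 w d"
    using orthogonal_to_two_parallel_cross[OF assms(4,5) orthogonal_cross_nonzero[OF assms(1-3)]] by blast
  then show ?thesis using assms(6) by simp
qed

lemma unit_parallel_cases:
  fixes x y :: R3
  assumes "x = c *\<^sub>R y" "norm x = 1" "norm y = 1"
  shows "x = y \<or> x = - y"
proof -
  have "\<bar>c\<bar> = 1" using assms by simp
  then have "c = 1 \<or> c = -1" by linarith
  then show ?thesis using assms(1) by auto
qed

text \<open>A polygon has as many vertices as edges: an edge with outer normal \<open>d\<close> is matched with its end
  point in the direction \<open>w \<times> d\<close>, where \<open>w\<close> is normal to the polygon.\<close>

lemma card_extreme_points_polygon:
  fixes K :: "R3 set" and w :: R3
  assumes K: "polytope K" "K \<noteq> {}" and w: "w \<noteq> 0" and Kw: "\<And>x. x \<in> K \<Longrightarrow> x \<bullet> w = 0"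
    and flat: "\<And>d. d \<noteq> 0 \<Longrightarrow> d \<bullet> w = 0 \<Longrightarrow> \<exists>x\<in>K. \<exists>y\<in>K. d \<bullet> x \<noteq> d \<bullet> y"
  shows "card {v. v extreme_point_of K} =
    card {d. norm d = 1 \<and> d \<bullet> w = 0 \<and> (\<exists>x\<in>support_face K d. \<exists>y\<in>support_face K d. x \<noteq> y)}"
    (is "_ = card ?D")
proof -
  let ?E = "\<lambda>d. support_face (support_face K d) (cross3 w d)"
  have cvx: "convex K" by (intro polytope_imp_convex K)
  have sing: "\<exists>v. ?E d = {v}" if d: "d \<noteq> 0" "d \<bullet> w = 0" for d
  proof -
    have "support_face K d \<noteq> {}" by (intro support_face_nonempty K)
    then have ne: "?E d \<noteq> {}" by (intro support_face_nonempty polytope_support_face K)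
    have "x = y" if xy: "x \<in> ?E d" "y \<in> ?E d" for x y
    proof -
      have xy': "x \<in> support_face K d" "y \<in> support_face K d"
        using xy support_face_subset by blast+
      have "(x - y) \<bullet> w = 0" using xy' support_face_subset Kw by (metis inner_diff_left subsetD diff_self)
      moreover have "(x - y) \<bullet> d = 0"
        using support_face_inner_eq[OF xy'] by (simp add: inner_diff_left inner_diff_right inner_commute)
      moreover have "(x - y) \<bullet> cross3 w d = 0"
        using support_face_inner_eq[OF xy] by (simp add: inner_diff_left inner_diff_right inner_commute)
      ultimately have "x - y = 0" by (rule orthogonal_basis_zero[OF d(2,1) w])
      then show ?thesis by simp
    qed
    with ne show ?thesis by blast
  qed
  define f where "f d = (THE v. ?E d = {v})" for d
  have f: "?E d = {f d}" if "d \<noteq> 0" "d \<bullet> w = 0" for d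
    using sing[OF that] unfolding f_def by auto
  have ext: "f d extreme_point_of K" if "d \<noteq> 0" "d \<bullet> w = 0" for d
  proof -
    have "?E d face_of support_face K d"
      by (intro support_face_face_of polytope_imp_convex polytope_support_face K)
    then have "{f d} face_of K" using f[OF that] face_of_trans support_face_face_of[OF cvx] by metis
    then show ?thesis by (simp add: face_of_singleton)
  qed
  have nz: "d \<noteq> 0" if "d \<in> ?D" for d using that by auto
  \<comment> \<open>The edge with normal \<open>d\<close> runs from \<open>x\<close> to
    \<open>f d\<close> in the direction \<open>w \<times> d\<close>. A functional maximal at
    \<open>f d\<close> cannot decrease along it.\<close>
  have side: "e \<bullet> cross3 w d \<ge> 0" if d: "d \<in> ?D" and e: "f d \<in> support_face K e" for d e
  proof -
    have dw: "d \<noteq> 0" "d \<bullet> w = 0" using d by auto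
    obtain p q where "p \<in> support_face K d" "q \<in> support_face K d" "p \<noteq> q" using d by auto
    then obtain x where x: "x \<in> support_face K d" "x \<noteq> f d" by metis
    have fd: "f d \<in> ?E d" using f[OF dw] by blast
    then have fd': "f d \<in> support_face K d" using support_face_subset by blast
    have le: "cross3 w d \<bullet> x \<le> cross3 w d \<bullet> f d"
      using fd x by (auto simp: support_face_def[of "support_face K d"])
    have "(f d - x) \<bullet> w = 0" using fd' x support_face_subset Kw by (metis inner_diff_left subsetD diff_self)
    moreover have "(f d - x) \<bullet> d = 0"
      using support_face_inner_eq[OF fd' x(1)] by (simp add: inner_diff_left inner_diff_right inner_commute)
    ultimately obtain t where t: "f d - x = t *\<^sub>R cross3 w d"
      using orthogonal_to_two_parallel_cross orthogonal_cross_nonzero[OF dw(2,1) w] by blast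
    have "t \<noteq> 0" using t x by auto
    moreover have "0 \<le> t * (cross3 w d \<bullet> cross3 w d)"
      using le t by (metis diff_ge_0_iff_ge inner_diff_right inner_scaleR_right)
    moreover have "0 < cross3 w d \<bullet> cross3 w d"
      using orthogonal_cross_nonzero[OF dw(2,1) w] by simp
    ultimately have "t > 0" using mult_neg_pos[of t "cross3 w d \<bullet> cross3 w d"] by linarith
    have "e \<bullet> x \<le> e \<bullet> f d" using e x support_face_subset by (auto simp: support_face_def)
    then have "0 \<le> t * (e \<bullet> cross3 w d)"
      using t by (metis diff_ge_0_iff_ge inner_diff_right inner_scaleR_right)
    then show ?thesis using \<open>t > 0\<close> by (simp add: zero_le_mult_iff)
  qed
  have fK: "f d \<in> support_face K d" if "d \<in> ?D" for d
    using f[OF nz[OF that]] that support_face_subset[of "support_face K d"] by auto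
  \<comment> \<open>For normals \<open>d\<close> and \<open>e\<close> with the same end point,
    \<open>side\<close> applies in both orders. The triple product changes sign when
    \<open>d\<close> and \<open>e\<close> are exchanged, so it is zero and \<open>d\<close>,
    \<open>e\<close> are parallel.\<close>
  have "inj_on f ?D"
  proof (rule inj_onI)
    fix d e assume de: "d \<in> ?D" "e \<in> ?D" "f d = f e"
    have "e \<bullet> cross3 w d \<ge> 0" using side[OF de(1)] fK[OF de(2)] de(3) by simp
    moreover have "d \<bullet> cross3 w e \<ge> 0" using side[OF de(2)] fK[OF de(1)] de(3) by simp
    moreover have "d \<bullet> cross3 w e = - (e \<bullet> cross3 w d)" by (simp add: cross3_simps)
    ultimately have "e \<bullet> cross3 w d = 0" by linarith
    moreover have ew: "e \<bullet> w = 0" "d \<bullet> w = 0" using de by auto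
    moreover have "cross3 w (cross3 w d) \<noteq> 0"
      by (rule orthogonal_cross_nonzero[OF _ orthogonal_cross_nonzero[OF ew(2) nz[OF de(1)] w] w])
        (simp add: dot_cross_self)
    ultimately obtain c where "e = c *\<^sub>R cross3 w (cross3 w d)"
      using orthogonal_to_two_parallel_cross by blast
    then have "e = (- c * (w \<bullet> w)) *\<^sub>R d" using ew by (simp add: Lagrange inner_commute)
    from unit_parallel_cases[OF this] have "e = d \<or> e = - d" using de by simp
    moreover have "e \<noteq> - d"
    proof
      assume "e = - d"
      then have "f d \<in> support_face K d" "f d \<in> support_face K (- d)"
        using fK[OF de(1)] fK[OF de(2)] de(3) by simp_all
      then have "d \<bullet> x \<le> d \<bullet> f d" "d \<bullet> f d \<le> d \<bullet> x" if "x \<in> K" for x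
        using that by (auto simp: support_face_def)
      then have "d \<bullet> x = d \<bullet> f d" if "x \<in> K" for x
        using that by (metis order_antisym)
      then show False using flat[OF nz[OF de(1)] ew(2)] by auto
    qed
    ultimately show "d = e" by simp
  qed
  moreover have "f ` ?D = {v. v extreme_point_of K}"
  proof (intro equalityI subsetI)
    fix v assume "v \<in> f ` ?D"
    then show "v \<in> {v. v extreme_point_of K}" using ext nz by auto
  next
    fix v assume "v \<in> {v. v extreme_point_of K}"
    then have v: "v extreme_point_of K" by simp
    then have vK: "v \<in> K" by (simp add: extreme_point_of_def)
    \<comment> \<open>For surjectivity, a functional maximal only at the vertex \<open>v\<close> is
      made orthogonal to \<open>w\<close> and then turned until it supports an edge ending at
      \<open>v\<close>.\<close>
    have "{v} exposed_face_of K"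
      using v K exposed_face_of_polyhedron polytope_imp_polyhedron face_of_singleton by blast
    then obtain e0 b0 where e0: "K \<subseteq> {x. e0 \<bullet> x \<le> b0}" "{v} = K \<inter> {x. e0 \<bullet> x = b0}"
      by (auto simp: exposed_face_of_def)
    define e where "e = proj_plane w e0"
    have ew: "e \<bullet> w = 0" using w by (simp add: e_def proj_plane_def inner_diff_left)
    have ex: "e \<bullet> x = e0 \<bullet> x" if "x \<in> K" for x
    proof -
      have "w \<bullet> x = 0" using Kw[OF that] by (simp add: inner_commute)
      then show ?thesis by (simp add: e_def proj_plane_def inner_diff_left)
    qed
    let ?V = "{x. x extreme_point_of K} - {v}"
    have hull: "K = convex hull {x. x extreme_point_of K}"
      by (intro Krein_Milman_Minkowski polytope_imp_compact cvx K)
    have finV: "finite ?V"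
      using finite_polyhedron_extreme_points[OF polytope_imp_polyhedron[OF K(1)]] by simp
    have "?V \<noteq> {}"
    proof
      assume "?V = {}"
      then have "{x. x extreme_point_of K} = {v}" using v by blast
      then have "K = {v}" using hull by simp
      moreover obtain d :: R3 where "d \<noteq> 0" "orthogonal w d"
        using orthogonal_to_vector_exists[of w] by auto
      ultimately show False using flat[of d] by (auto simp: orthogonal_def inner_commute)
    qed
    have VK: "x \<in> K" if "x \<in> ?V" for x using that by (auto simp: extreme_point_of_def)
    \<comment> \<open>Coordinates around \<open>v\<close>: \<open>a x\<close> is the depth of
      \<open>x\<close> below the support line with normal \<open>e\<close>, and \<open>b x\<close>
      measures the displacement along that line.\<close>
    define a where "a x = - (e \<bullet> (x - v))" for x
    define b where "b x = cross3 w e \<bullet> (x - v)" for x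
    have a: "a x > 0" if "x \<in> ?V" for x
    proof -
      have "e0 \<bullet> x \<noteq> b0" using e0(2) VK[OF that] that by auto
      moreover have "e0 \<bullet> x \<le> b0" using e0(1) VK[OF that] by auto
      moreover have "e0 \<bullet> v = b0" using e0(2) by auto
      ultimately show ?thesis using ex[OF vK] ex[OF VK[OF that]] by (simp add: a_def inner_diff_right)
    qed
    \<comment> \<open>The least \<open>c\<close> for which no vertex lies beyond the line through
      \<open>v\<close> with normal \<open>c e - w \<times> e\<close>. A vertex attaining the maximum
      lies on the line and becomes the second point of the edge.\<close>
    define c where "c = Max ((\<lambda>x. - b x / a x) ` ?V)"
    have cge: "- b x / a x \<le> c" if "x \<in> ?V" for x
      unfolding c_def by (intro Max_ge finite_imageI finV imageI that)
    have "c \<in> (\<lambda>x. - b x / a x) ` ?V"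
      unfolding c_def using finV \<open>?V \<noteq> {}\<close> by (intro Max_in) auto
    then obtain x0 where x0: "x0 \<in> ?V" "c = - b x0 / a x0" by blast
    define d where "d = c *\<^sub>R e - cross3 w e"
    have dx: "d \<bullet> (x - v) = - c * a x - b x" for x
      by (simp add: d_def a_def b_def inner_diff_left)
    have wd: "cross3 w d = c *\<^sub>R cross3 w e + (w \<bullet> w) *\<^sub>R e"
      using ew by (simp add: d_def Cross3.right_diff_distrib Lagrange cross_mult_right inner_commute)
    \<comment> \<open>Every other vertex on the edge lies behind \<open>v\<close> in the direction
      \<open>w \<times> d\<close>, so \<open>v\<close> is the end point that \<open>f\<close>
      assigns to this edge.\<close>
    have neg: "cross3 w d \<bullet> (x - v) < 0" if "x \<in> ?V" "d \<bullet> (x - v) = 0" for x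
    proof -
      have bx: "b x = - (c * a x)" using that(2) unfolding dx by simp
      have "cross3 w d \<bullet> (x - v) = c * b x - (w \<bullet> w) * a x"
        by (simp add: wd inner_add_left a_def b_def)
      also have "\<dots> = - (c\<^sup>2 + w \<bullet> w) * a x"
        using bx by (simp add: algebra_simps power2_eq_square)
      also have "\<dots> < 0"
        using mult_pos_pos[of "c\<^sup>2 + w \<bullet> w", OF add_nonneg_pos a[OF that(1)]] w by (simp add: algebra_simps)
      finally show ?thesis .
    qed
    have dx0: "d \<bullet> (x0 - v) = 0" using x0 a[OF x0(1)] by (simp add: dx)
    have d0: "d \<noteq> 0" using neg[OF x0(1) dx0] by auto
    have dw: "d \<bullet> w = 0" by (simp add: d_def inner_diff_left ew dot_cross_self)
    have "{x. x extreme_point_of K} \<subseteq> {y. d \<bullet> y \<le> d \<bullet> v}"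
    proof
      fix x assume x: "x \<in> {x. x extreme_point_of K}"
      have "d \<bullet> (x - v) \<le> 0" if "x \<in> ?V"
        using cge[OF that] a[OF that] by (simp add: dx field_simps)
      then show "x \<in> {y. d \<bullet> y \<le> d \<bullet> v}" using x by (cases "x = v") (auto simp: inner_diff_right)
    qed
    then have Kd: "K \<subseteq> {y. d \<bullet> y \<le> d \<bullet> v}"
      using hull convex_halfspace_le hull_minimal by metis
    then have vd: "v \<in> support_face K d" using vK by (auto simp: support_face_def)
    have x0d: "x0 \<in> support_face K d"
      using Kd VK[OF x0(1)] dx0 by (auto simp: support_face_def inner_diff_right)
    have "f d = v"
    proof (rule ccontr)
      assume "f d \<noteq> v"
      then have fV: "f d \<in> ?V" using ext[OF d0 dw] by simp
      have fE: "f d \<in> ?E d" using f[OF d0 dw] by simp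
      then have "f d \<in> support_face K d" using support_face_subset by blast
      then have "d \<bullet> (f d - v) = 0" using support_face_inner_eq[OF _ vd] by (simp add: inner_diff_right)
      from neg[OF fV this] have "cross3 w d \<bullet> f d < cross3 w d \<bullet> v" by (simp add: inner_diff_right)
      moreover have "cross3 w d \<bullet> v \<le> cross3 w d \<bullet> f d"
        using fE vd by (auto simp: support_face_def[of "support_face K d"])
      ultimately show False by simp
    qed
    define d' where "d' = (1 / norm d) *\<^sub>R d"
    have sc: "support_face K d' = support_face K d"
      unfolding d'_def using d0 by (intro support_face_scaleR) simp
    have "?E d' = ?E d"
      unfolding sc unfolding d'_def cross_mult_right using d0 by (intro support_face_scaleR) simp
    then have "f d' = v" using \<open>f d = v\<close> by (simp add: f_def)
    moreover have "d' \<in> ?D"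
      using vd x0d x0(1) d0 dw unfolding mem_Collect_eq sc by (auto simp: d'_def)
    ultimately show "v \<in> f ` ?D" by blast
  qed
  ultimately show ?thesis using card_image by fastforce
qed

subsection \<open>Counting the vertices of a projection\<close>

lemma full_dim_not_const:
  fixes R :: "R3 set"
  assumes "aff_dim R = 3" "d \<noteq> 0"
  shows "\<exists>x\<in>R. \<exists>y\<in>R. d \<bullet> x \<noteq> d \<bullet> y"
proof (rule ccontr)
  assume *: "\<not> ?thesis"
  obtain r where "R \<subseteq> {x. d \<bullet> x = r}"
  proof (cases "R = {}")
    case False
    then obtain p where "p \<in> R" by blast
    with * show ?thesis using that[of "d \<bullet> p"] by blast
  qed simp
  then have "aff_dim R \<le> aff_dim {x. d \<bullet> x = r}" by (rule aff_dim_subset)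
  then show False using assms by simp
qed

lemma linear_proj_plane: "linear (proj_plane w)"
  unfolding proj_plane_def
  by (rule linearI) (simp_all add: algebra_simps inner_add_left add_divide_distrib)

lemma proj_plane_orthogonal: "proj_plane w x \<bullet> w = 0"
  by (cases "w = 0") (simp_all add: proj_plane_def inner_diff_left)

lemma inner_proj_plane: "d \<bullet> w = 0 \<Longrightarrow> d \<bullet> proj_plane w x = d \<bullet> x"
  by (simp add: proj_plane_def inner_diff_right)

lemma support_face_proj_plane:
  assumes "d \<bullet> w = 0"
  shows "support_face (proj_plane w ` R) d = proj_plane w ` support_face R d"
  unfolding support_face_def using inner_proj_plane[OF assms] by auto

text \<open>The image lies in a plane. Adding the single point \<open>p + w\<close> gives a set
  whose affine hull contains \<open>R\<close>, so at most one dimension is lost.\<close>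

lemma aff_dim_proj_plane:
  assumes R: "aff_dim R = 3" and w: "w \<noteq> 0"
  shows "aff_dim (proj_plane w ` R) = 2"
proof -
  let ?K = "proj_plane w ` R"
  have "?K \<subseteq> {x. w \<bullet> x = 0}" using proj_plane_orthogonal by (auto simp: inner_commute)
  then have "aff_dim ?K \<le> aff_dim {x. w \<bullet> x = 0}" by (rule aff_dim_subset)
  then have le: "aff_dim ?K \<le> 2" using w by simp
  have "R \<noteq> {}" using R by auto
  then obtain p where p: "p \<in> ?K" by blast
  let ?H = "affine hull (insert (p + w) ?K)"
  have "R \<subseteq> ?H"
  proof
    fix x assume "x \<in> R"
    then have k: "proj_plane w x \<in> ?H" by (auto intro: hull_inc)
    have "x = proj_plane w x + (x \<bullet> w / (w \<bullet> w)) *\<^sub>R ((p + w) - p)"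
      by (simp add: proj_plane_def)
    also have "\<dots> \<in> ?H"
      by (rule mem_affine_3_minus[OF affine_affine_hull k]) (use p in \<open>auto intro: hull_inc\<close>)
    finally show "x \<in> ?H" .
  qed
  then have "aff_dim R \<le> aff_dim ?H" by (rule aff_dim_subset)
  then have "3 \<le> aff_dim (insert (p + w) ?K)" using R by simp
  also have "\<dots> \<le> aff_dim ?K + 1" by (simp add: aff_dim_insert)
  finally show ?thesis using le by simp
qed

text \<open>With \<open>n = a \<times> b\<close> orthogonal to \<open>w\<close>, the vector
  \<open>(n \<bullet> n) w\<close> equals \<open>n \<times> (w \<times> n)\<close>, and expanding
  the triple products leaves a combination of \<open>a\<close> and \<open>b\<close>.\<close>

lemma orthogonal_to_cross_in_span:
  fixes a b w :: R3
  assumes "w \<bullet> cross3 a b = 0" "cross3 a b \<noteq> 0"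
  shows "w \<in> span {a, b}"
proof -
  let ?n = "cross3 a b"
  have "(?n \<bullet> ?n) *\<^sub>R w = cross3 ?n (cross3 w ?n)"
    using assms by (simp add: Lagrange[of ?n] inner_commute)
  also have "\<dots> = (w \<bullet> b) *\<^sub>R cross3 ?n a - (w \<bullet> a) *\<^sub>R cross3 ?n b"
    by (simp add: Lagrange[of w] Cross3.right_diff_distrib cross_mult_right)
  also have "\<dots> = (w \<bullet> b) *\<^sub>R ((a \<bullet> a) *\<^sub>R b - (a \<bullet> b) *\<^sub>R a) - (w \<bullet> a) *\<^sub>R ((b \<bullet> a) *\<^sub>R b - (b \<bullet> b) *\<^sub>R a)"
    by (simp add: cross_skew[of ?n] Lagrange)
  also have "\<dots> \<in> span {a, b}"
    by (intro span_diff span_scale span_base) auto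
  finally have "(1 / (?n \<bullet> ?n)) *\<^sub>R (?n \<bullet> ?n) *\<^sub>R w \<in> span {a, b}" by (rule span_scale)
  then show ?thesis using assms(2) by simp
qed

lemma has_segment_orthogonal:
  assumes "has_segment (support_face R d) u"
  shows "d \<bullet> u = 0"
proof -
  obtain x y c where x: "x \<in> support_face R d" "y \<in> support_face R d" "x \<noteq> y" "x - y = c *\<^sub>R u"
    using assms by (auto simp: has_segment_def)
  have "d \<bullet> (x - y) = 0" using support_face_inner_eq[OF x(1,2)] by (simp add: inner_diff_right)
  then have "c * (d \<bullet> u) = 0" using x(4) by simp
  moreover have "c \<noteq> 0" using x by auto
  ultimately show ?thesis by simp
qed

context
  fixes R :: "R3 set" and w :: R3
  assumes R: "polytope R" "aff_dim R = 3" and w: "w \<noteq> 0"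
    and facets: "\<And>F. F facet_of R \<Longrightarrow> \<not> plane_orth_to_facet w F"
begin

lemma full_dim_nonempty: "R \<noteq> {}"
  using R(2) by auto

lemma support_face_neq_full_dim: "d \<noteq> 0 \<Longrightarrow> support_face R d \<noteq> R"
  using full_dim_not_const[OF R(2)] support_face_inner_eq by metis

text \<open>A non-collinear face of \<open>d\<close> would be a facet with normal \<open>d\<close>,
  and \<open>d \<bullet> w = 0\<close> would make \<open>w\<close> parallel to it.\<close>

lemma collinear_support_face_if_orth:
  assumes d: "d \<noteq> 0" "d \<bullet> w = 0"
  shows "collinear (support_face R d)"
proof (rule ccontr)
  let ?F = "support_face R d"
  assume nc: "\<not> collinear ?F"
  have face: "?F face_of R" by (intro support_face_face_of polytope_imp_convex R)
  have "aff_dim ?F < 3"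
    using face_of_aff_dim_lt[OF polytope_imp_convex[OF R(1)] face support_face_neq_full_dim[OF d(1)]] R(2) by simp
  moreover have "\<not> aff_dim ?F \<le> 1" using nc by (simp add: collinear_aff_dim)
  ultimately have "?F facet_of R"
    using face R support_face_nonempty[OF R(1) full_dim_nonempty] by (simp add: facet_of_def)
  then have "\<not> plane_orth_to_facet w ?F" by (rule facets)
  obtain x y z where x: "x \<in> ?F" "y \<in> ?F" "z \<in> ?F" "cross3 (x - y) (x - z) \<noteq> 0"
    using not_collinear_obtain[OF nc] by metis
  have "d \<bullet> x = d \<bullet> y" "d \<bullet> x = d \<bullet> z" using support_face_inner_eq x by blast+
  then obtain c where c: "d = c *\<^sub>R cross3 (x - y) (x - z)"
    using orthogonal_to_two_parallel_cross[OF _ _ x(4), of d] by (auto simp: inner_diff_right)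
  have "w \<bullet> cross3 (x - y) (x - z) = 0" using c d by (simp add: inner_commute)
  then have "w \<in> span {x - y, x - z}" using x(4) by (rule orthogonal_to_cross_in_span)
  also have "\<dots> \<subseteq> span {x - y | x y. x \<in> ?F \<and> y \<in> ?F}"
    using x by (intro span_mono) blast
  finally show False using \<open>\<not> plane_orth_to_facet w ?F\<close> by (simp add: plane_orth_to_facet_def)
qed

lemma generic_dir_if_orth: "d \<noteq> 0 \<Longrightarrow> d \<bullet> w = 0 \<Longrightarrow> generic_dir R d"
  using collinear_support_face_if_orth[of d] collinear_support_face_if_orth[of "- d"]
  by (simp add: generic_dir_def)

text \<open>A proper face lies in a facet, so a segment of direction \<open>w\<close> would make
  \<open>w\<close> parallel to a facet.\<close>

lemma not_has_segment_projection_direction: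
  assumes d: "d \<noteq> 0"
  shows "\<not> has_segment (support_face R d) w"
proof
  let ?F = "support_face R d"
  assume "has_segment ?F w"
  then obtain x y c where x: "x \<in> ?F" "y \<in> ?F" "x \<noteq> y" "x - y = c *\<^sub>R w"
    by (auto simp: has_segment_def)
  have "?F face_of R" by (intro support_face_face_of polytope_imp_convex R)
  then obtain G where G: "G facet_of R" "?F \<subseteq> G"
    using face_of_polyhedron_subset_facet[OF polytope_imp_polyhedron[OF R(1)], of ?F]
      support_face_nonempty[OF R(1) full_dim_nonempty] support_face_neq_full_dim[OF d] by blast
  have "c \<noteq> 0" using x by auto
  then have "w = (1 / c) *\<^sub>R (x - y)" using x(4) by simp
  moreover have "(1 / c) *\<^sub>R (x - y) \<in> span {x - y | x y. x \<in> G \<and> y \<in> G}"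
    using x G by (intro span_scale span_base) blast
  ultimately show False using facets[OF G(1)] by (simp add: plane_orth_to_facet_def)
qed

text \<open>The polygon count applies to the projection, whose faces are the projected faces of
  \<open>R\<close>. Two points of one face never collapse, since no such face contains a segment of
  direction \<open>w\<close>.\<close>

lemma card_extreme_points_proj_plane:
  "card {v. v extreme_point_of (proj_plane w ` R)} =
   card {d. norm d = 1 \<and> d \<bullet> w = 0 \<and> (\<exists>x\<in>support_face R d. \<exists>y\<in>support_face R d. x \<noteq> y)}"
proof -
  let ?K = "proj_plane w ` R"
  have "card {v. v extreme_point_of ?K} =
    card {d. norm d = 1 \<and> d \<bullet> w = 0 \<and> (\<exists>x\<in>support_face ?K d. \<exists>y\<in>support_face ?K d. x \<noteq> y)}"
  proof (rule card_extreme_points_polygon)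
    show "polytope ?K" by (intro polytope_linear_image linear_proj_plane R)
    show "\<exists>x\<in>?K. \<exists>y\<in>?K. d \<bullet> x \<noteq> d \<bullet> y" if "d \<noteq> 0" "d \<bullet> w = 0" for d
      using full_dim_not_const[OF R(2) that(1)] inner_proj_plane[OF that(2)] by auto
  qed (use full_dim_nonempty w proj_plane_orthogonal in auto)
  also have "(\<exists>x\<in>support_face ?K d. \<exists>y\<in>support_face ?K d. x \<noteq> y) \<longleftrightarrow>
      (\<exists>x\<in>support_face R d. \<exists>y\<in>support_face R d. x \<noteq> y)" if "norm d = 1" "d \<bullet> w = 0" for d
  proof -
    have inj: "proj_plane w x \<noteq> proj_plane w y"
      if xy: "x \<in> support_face R d" "y \<in> support_face R d" "x \<noteq> y" for x y
    proof
      assume "proj_plane w x = proj_plane w y"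
      then have "x - y = (x \<bullet> w / (w \<bullet> w) - y \<bullet> w / (w \<bullet> w)) *\<^sub>R w"
        by (simp add: proj_plane_def algebra_simps)
      then have "has_segment (support_face R d) w" using xy by (auto simp: has_segment_def)
      then show False using not_has_segment_projection_direction[of d] \<open>norm d = 1\<close> by (cases "d = 0") auto
    qed
    show ?thesis
      unfolding support_face_proj_plane[OF that(2)] bex_simps using inj by (metis (no_types, lifting))
  qed
  then have "{d. norm d = 1 \<and> d \<bullet> w = 0 \<and> (\<exists>x\<in>support_face ?K d. \<exists>y\<in>support_face ?K d. x \<noteq> y)} =
    {d. norm d = 1 \<and> d \<bullet> w = 0 \<and> (\<exists>x\<in>support_face R d. \<exists>y\<in>support_face R d. x \<noteq> y)}"
    by blast
  finally show ?thesis .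
qed

end

section \<open>Normalised edge directions and the vertex count as a sum over them\<close>

lemma first_nonzero_pos_minus: "first_nonzero_pos u \<Longrightarrow> \<not> first_nonzero_pos (- u)"
  by (auto simp: first_nonzero_pos_def)

lemma first_nonzero_pos_cases: "u \<noteq> 0 \<Longrightarrow> first_nonzero_pos u \<or> first_nonzero_pos (- u)"
  by (auto simp: first_nonzero_pos_def vec_eq_iff forall_3)

lemma first_nonzero_pos_scaleR: "c > 0 \<Longrightarrow> first_nonzero_pos (c *\<^sub>R u) \<longleftrightarrow> first_nonzero_pos u"
  by (auto simp: first_nonzero_pos_def zero_less_mult_iff)

lemma normalized_parallel_eq:
  assumes "u = c *\<^sub>R v" "norm u = 1" "norm v = 1" "first_nonzero_pos u" "first_nonzero_pos v"
  shows "u = v"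
  using unit_parallel_cases[OF assms(1-3)] assms(4,5) first_nonzero_pos_minus by auto

lemma normalized_direction_exists:
  assumes "x \<noteq> 0"
  shows "\<exists>u c. norm u = 1 \<and> first_nonzero_pos u \<and> x = c *\<^sub>R u"
proof -
  define s where "s = (if first_nonzero_pos x then 1 else - 1 :: real)"
  define u where "u = (s / norm x) *\<^sub>R x"
  have "u = (1 / norm x) *\<^sub>R (s *\<^sub>R x)" by (simp add: u_def)
  moreover have "first_nonzero_pos (s *\<^sub>R x)"
    using first_nonzero_pos_cases[OF assms] by (auto simp: s_def)
  ultimately have "first_nonzero_pos u"
    using first_nonzero_pos_scaleR[of "1 / norm x" "s *\<^sub>R x"] assms by simp
  moreover have "norm u = 1" using assms by (simp add: u_def s_def)
  moreover have "x = (norm x / s) *\<^sub>R u" using assms by (simp add: u_def s_def)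
  ultimately show ?thesis by blast
qed

text \<open>Edge directions are described through outer normals, without extreme points, to fit the
  way edges are counted.\<close>

definition edge_dirs :: "R3 set \<Rightarrow> R3 set" where
  "edge_dirs R = {u. norm u = 1 \<and> first_nonzero_pos u \<and>
     (\<exists>d. d \<noteq> 0 \<and> collinear (support_face R d) \<and> has_segment (support_face R d) u)}"

text \<open>This is the function \<open>g\<close> of the direction \<open>u\<close>, with membership
  in the cone replaced by a property of the face; the two agree at generic vectors.\<close>

definition segment_count :: "R3 set \<Rightarrow> R3 \<Rightarrow> R3 \<Rightarrow> nat" where
  "segment_count R u d = of_bool (has_segment (support_face R d) u) +
     of_bool (has_segment (support_face R (- d)) u)"

lemma segment_count_scaleR:
  assumes "c \<noteq> 0"
  shows "segment_count R u (c *\<^sub>R d) = segment_count R u d"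
proof (cases "c > 0")
  case True
  then show ?thesis
    using support_face_scaleR[of c R d] support_face_scaleR[of c R "- d"] by (simp add: segment_count_def)
next
  case False
  then show ?thesis
    using support_face_scaleR[of "- c" R d] support_face_scaleR[of "- c" R "- d"] assms
    by (simp add: segment_count_def)
qed

lemma collinear_has_segment_unique:
  assumes "collinear S" "has_segment S u" "has_segment S v"
    "norm u = 1" "norm v = 1" "first_nonzero_pos u" "first_nonzero_pos v"
  shows "u = v"
proof -
  obtain x y c where x: "x \<in> S" "y \<in> S" "x \<noteq> y" "x - y = c *\<^sub>R u"
    using assms(2) by (auto simp: has_segment_def)
  obtain c' where c': "x - y = c' *\<^sub>R v" using collinear_has_segment[OF assms(1,3) x(1,2)] by blast
  have "c \<noteq> 0" using x by auto
  then have "u = (1 / c) *\<^sub>R (c *\<^sub>R u)" by simp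
  also have "\<dots> = (c' / c) *\<^sub>R v" by (simp only: x(4)[symmetric] c') simp
  finally have "u = (c' / c) *\<^sub>R v" .
  from normalized_parallel_eq[OF this assms(4-7)] show ?thesis .
qed

lemma edge_dirs_cross_nonzero:
  assumes "polytope R" "aff_dim R = 3" "w \<noteq> 0" "\<And>F. F facet_of R \<Longrightarrow> \<not> plane_orth_to_facet w F"
    and u: "u \<in> edge_dirs R"
  shows "cross3 u w \<noteq> 0"
proof
  assume "cross3 u w = 0"
  then obtain c where c: "u = c *\<^sub>R w" using parallel_if_cross_eq_0 assms(3) by blast
  obtain e where e: "e \<noteq> 0" "has_segment (support_face R e) u"
    using u by (auto simp: edge_dirs_def)
  then have "has_segment (support_face R e) w" unfolding has_segment_def c by force
  then show False using not_has_segment_projection_direction[OF assms(1-4) e(1)] by blast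
qed

text \<open>A collinear face determines its normalised direction, so the map \<open>h\<close> from
  the finitely many faces covers all edge directions.\<close>

lemma finite_edge_dirs:
  assumes "polytope R"
  shows "finite (edge_dirs R)"
proof -
  define h where "h F = (THE u. norm u = 1 \<and> first_nonzero_pos u \<and> has_segment F u)" for F
  have "edge_dirs R \<subseteq> h ` {F. F face_of R}"
  proof
    fix u assume "u \<in> edge_dirs R"
    then obtain d where u: "norm u = 1" "first_nonzero_pos u" and
      d: "collinear (support_face R d)" "has_segment (support_face R d) u"
      by (auto simp: edge_dirs_def)
    have "h (support_face R d) = u"
      unfolding h_def using u d by (intro the_equality) (auto intro: collinear_has_segment_unique[OF d(1)])
    moreover have "support_face R d face_of R"
      by (intro support_face_face_of polytope_imp_convex assms)
    ultimately show "u \<in> h ` {F. F face_of R}" by blast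
  qed
  then show ?thesis using finite_polytope_faces[OF assms] finite_subset by blast
qed

lemma unit_orthogonal_pair:
  fixes u w :: R3
  assumes "cross3 u w \<noteq> 0"
  shows "{d. norm d = 1 \<and> d \<bullet> u = 0 \<and> d \<bullet> w = 0} =
    {(1 / norm (cross3 u w)) *\<^sub>R cross3 u w, - ((1 / norm (cross3 u w)) *\<^sub>R cross3 u w)}"
    (is "_ = {?m, - ?m}")
proof (intro equalityI subsetI)
  fix d assume "d \<in> {d. norm d = 1 \<and> d \<bullet> u = 0 \<and> d \<bullet> w = 0}"
  then have d: "norm d = 1" "d \<bullet> u = 0" "d \<bullet> w = 0" by auto
  obtain c where "d = c *\<^sub>R cross3 u w"
    using orthogonal_to_two_parallel_cross[OF d(2,3) assms] by blast
  then have "d = (c * norm (cross3 u w)) *\<^sub>R ?m" using assms by simp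
  from unit_parallel_cases[OF this] show "d \<in> {?m, - ?m}" using d assms by simp
next
  fix d assume "d \<in> {?m, - ?m}"
  then show "d \<in> {d. norm d = 1 \<and> d \<bullet> u = 0 \<and> d \<bullet> w = 0}"
    using assms by (auto simp: dot_cross_self)
qed

text \<open>The normals of projected edges are sorted by edge direction; the classes are disjoint
  because the faces are collinear, and each is contained in a pair of opposite vectors. The set
  \<open>U\<close> may exceed \<open>edge_dirs R\<close>, so that a direction of interest can be
  added: its class is empty if it is no edge direction.\<close>

lemma card_extreme_points_eq_sum:
  assumes R: "polytope R" "aff_dim R = 3" and w: "w \<noteq> 0"
    and facets: "\<And>F. F facet_of R \<Longrightarrow> \<not> plane_orth_to_facet w F"
    and U: "finite U" "edge_dirs R \<subseteq> U" "\<And>u. u \<in> U \<Longrightarrow> norm u = 1 \<and> first_nonzero_pos u"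
      "\<And>u. u \<in> U \<Longrightarrow> cross3 u w \<noteq> 0"
  shows "card {v. v extreme_point_of (proj_plane w ` R)} = (\<Sum>u\<in>U. segment_count R u (cross3 u w))"
proof -
  define D where "D u = {d. norm d = 1 \<and> d \<bullet> w = 0 \<and> has_segment (support_face R d) u}" for u
  have col: "collinear (support_face R d)" if "norm d = 1" "d \<bullet> w = 0" for d
    using collinear_support_face_if_orth[OF R w facets _ that(2)] that(1) by (cases "d = 0") auto
  have "{d. norm d = 1 \<and> d \<bullet> w = 0 \<and> (\<exists>x\<in>support_face R d. \<exists>y\<in>support_face R d. x \<noteq> y)} = (\<Union>u\<in>U. D u)"
  proof (intro equalityI subsetI)
    fix d assume "d \<in> {d. norm d = 1 \<and> d \<bullet> w = 0 \<and> (\<exists>x\<in>support_face R d. \<exists>y\<in>support_face R d. x \<noteq> y)}"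
    then obtain x y where d: "norm d = 1" "d \<bullet> w = 0"
      and x: "x \<in> support_face R d" "y \<in> support_face R d" "x \<noteq> y" by auto
    obtain u c where u: "norm u = 1" "first_nonzero_pos u" "x - y = c *\<^sub>R u"
      using normalized_direction_exists[of "x - y"] x by auto
    have s: "has_segment (support_face R d) u" using x u by (auto simp: has_segment_def)
    moreover have "d \<noteq> 0" using d by auto
    ultimately have "u \<in> edge_dirs R" using u col[OF d] by (auto simp: edge_dirs_def)
    then show "d \<in> (\<Union>u\<in>U. D u)" using U s d by (auto simp: D_def)
  next
    fix d assume "d \<in> (\<Union>u\<in>U. D u)"
    then show "d \<in> {d. norm d = 1 \<and> d \<bullet> w = 0 \<and> (\<exists>x\<in>support_face R d. \<exists>y\<in>support_face R d. x \<noteq> y)}"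
      by (auto simp: D_def has_segment_def)
  qed
  then have "card {v. v extreme_point_of (proj_plane w ` R)} = card (\<Union>u\<in>U. D u)"
    using card_extreme_points_proj_plane[OF R w facets] by simp
  moreover have D: "finite (D u) \<and> card (D u) = segment_count R u (cross3 u w)" if u: "u \<in> U" for u
  proof -
    let ?m = "(1 / norm (cross3 u w)) *\<^sub>R cross3 u w"
    have "D u = {d. norm d = 1 \<and> d \<bullet> u = 0 \<and> d \<bullet> w = 0} \<inter> {d. has_segment (support_face R d) u}"
      using has_segment_orthogonal by (auto simp: D_def)
    also have "\<dots> = {?m, - ?m} \<inter> {d. has_segment (support_face R d) u}"
      using unit_orthogonal_pair[OF U(4)[OF u]] by simp
    finally have Du: "D u = {?m, - ?m} \<inter> {d. has_segment (support_face R d) u}" .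
    have m0: "?m \<noteq> 0" using U(4)[OF u] by simp
    have "?m \<noteq> - ?m"
    proof
      assume "?m = - ?m"
      then have "2 *\<^sub>R ?m = 0" unfolding scaleR_2 by (simp only: eq_neg_iff_add_eq_0)
      then show False using m0 by (simp only: scaleR_eq_0_iff) simp
    qed
    then have "card (D u) = segment_count R u ?m"
      unfolding Du segment_count_def
      by (cases "has_segment (support_face R ?m) u"; cases "has_segment (support_face R (- ?m)) u") simp_all
    then show ?thesis using segment_count_scaleR[of "1 / norm (cross3 u w)"] U(4)[OF u] Du by simp
  qed
  moreover have "D u \<inter> D v = {}" if "u \<in> U" "v \<in> U" "u \<noteq> v" for u v
    using collinear_has_segment_unique[OF col] U(3) that unfolding D_def by blast
  ultimately show ?thesis using card_UN_disjoint[OF U(1), of D] by simp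
qed

subsection \<open>Constant counts along an edge direction\<close>

lemma orthogonal_basis_decomposition:
  fixes u m y :: R3
  assumes "m \<bullet> u = 0" "m \<noteq> 0" "u \<noteq> 0" "y \<bullet> u = 0"
  shows "y = ((y \<bullet> m) / (m \<bullet> m)) *\<^sub>R m +
    ((y \<bullet> cross3 u m) / (cross3 u m \<bullet> cross3 u m)) *\<^sub>R cross3 u m" (is "y = ?a *\<^sub>R m + ?b *\<^sub>R _")
proof -
  have n: "cross3 u m \<noteq> 0" using orthogonal_cross_nonzero assms by blast
  have o: "m \<bullet> cross3 u m = 0" "cross3 u m \<bullet> m = 0" "cross3 u m \<bullet> u = 0" by (simp_all add: dot_cross_self)
  have "y - (?a *\<^sub>R m + ?b *\<^sub>R cross3 u m) = 0"
  proof (rule orthogonal_basis_zero[OF assms(1-3)])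
    show "(y - (?a *\<^sub>R m + ?b *\<^sub>R cross3 u m)) \<bullet> u = 0"
      using assms o by (simp add: inner_diff_left inner_add_left)
    show "(y - (?a *\<^sub>R m + ?b *\<^sub>R cross3 u m)) \<bullet> m = 0"
      using assms o by (simp add: inner_diff_left inner_add_left)
    show "(y - (?a *\<^sub>R m + ?b *\<^sub>R cross3 u m)) \<bullet> cross3 u m = 0"
      using n o by (simp add: inner_diff_left inner_add_left)
  qed
  then show ?thesis by simp
qed

lemma support_face_add_multiple:
  assumes "\<And>x y. x \<in> G \<Longrightarrow> y \<in> G \<Longrightarrow> m \<bullet> x = m \<bullet> y" "b \<noteq> 0"
  shows "support_face G (a *\<^sub>R m + b *\<^sub>R y) = support_face G (sgn b *\<^sub>R y)"
proof -
  have "support_face G (a *\<^sub>R m + b *\<^sub>R y) = support_face G (b *\<^sub>R y)"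
    by (rule support_face_add_const[OF assms(1)])
  moreover have "support_face G (\<bar>b\<bar> *\<^sub>R (sgn b *\<^sub>R y)) = support_face G (sgn b *\<^sub>R y)"
    using assms(2) by (intro support_face_scaleR) simp
  ultimately show ?thesis by (simp add: abs_mult_sgn)
qed

text \<open>Near \<open>u\<^sub>0\<close> the count for a direction \<open>u \<noteq> u\<^sub>0\<close> can only jump across the plane spanned by \<open>u\<close> and
  \<open>u\<^sub>0\<close>, so its values at two points symmetric about \<open>u\<^sub>0\<close> have a constant sum.\<close>

lemma segment_count_symmetric_sum:
  assumes P: "polytope P" "P \<noteq> {}" and u: "norm u = 1" and m0: "cross3 u u0 \<noteq> 0"
  shows "\<exists>T. \<forall>v. v \<bullet> cross3 u u0 \<noteq> 0 \<longrightarrow> (\<forall>\<^sub>F s in at_right 0.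
    segment_count P u (cross3 u (u0 + s *\<^sub>R v)) + segment_count P u (cross3 u (u0 - s *\<^sub>R v)) = T)"
proof -
  define m where "m = cross3 u u0"
  define h where "h a y = (of_bool (has_segment (support_face (support_face P a) y) u) :: nat)" for a y
  \<comment> \<open>The faces seen from \<open>m\<close> and from \<open>- m\<close> on both sides.
    Exchanging \<open>y\<close> and \<open>- y\<close> permutes the four terms, so the sign of the
    component of \<open>y\<close> along \<open>u \<times> m\<close> does not affect the sum.\<close>
  define \<tau> where "\<tau> y = h m y + h m (- y) + h (- m) y + h (- m) (- y)" for y
  have un: "u \<noteq> 0" using u by auto
  have mu: "m \<bullet> u = 0" by (simp add: m_def dot_cross_self)
  show ?thesis
  proof (intro exI[of _ "\<tau> (cross3 u m)"] allI impI)
    fix v assume "v \<bullet> cross3 u u0 \<noteq> 0"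
    then have vm: "v \<bullet> m \<noteq> 0" by (simp add: m_def)
    \<comment> \<open>The derivative of \<open>u \<times> (u0 + s v)\<close> in \<open>s\<close>.
      Its component along \<open>u \<times> m\<close> is non-zero by the choice of
      \<open>v\<close>.\<close>
    define y where "y = cross3 u v"
    have "y \<bullet> cross3 u m = (u \<bullet> u) * (v \<bullet> m) - (u \<bullet> m) * (v \<bullet> u)"
      unfolding y_def by (simp add: cross3_simps)
    also have "\<dots> = v \<bullet> m" using u mu by (simp add: inner_commute norm_eq_1)
    finally have ym: "y \<bullet> cross3 u m \<noteq> 0" using vm by simp
    have yu: "y \<bullet> u = 0" by (simp add: y_def dot_cross_self)
    obtain a b where y: "y = a *\<^sub>R m + b *\<^sub>R cross3 u m" and b: "b \<noteq> 0"
    proof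
      show "y = (y \<bullet> m / (m \<bullet> m)) *\<^sub>R m + (y \<bullet> cross3 u m / (cross3 u m \<bullet> cross3 u m)) *\<^sub>R cross3 u m"
        using orthogonal_basis_decomposition[OF mu _ un yu] m0 by (simp add: m_def)
      show "y \<bullet> cross3 u m / (cross3 u m \<bullet> cross3 u m) \<noteq> 0" using ym by auto
    qed
    have hy: "h c y = h c (sgn b *\<^sub>R cross3 u m)" "h c (- y) = h c (- (sgn b *\<^sub>R cross3 u m))"
      if "c = m \<or> c = - m" for c
    proof -
      have const: "m \<bullet> x = m \<bullet> z" if "x \<in> support_face P c" "z \<in> support_face P c" for x z
        using support_face_inner_eq[OF that] \<open>c = m \<or> c = - m\<close> by auto
      have "support_face (support_face P c) y = support_face (support_face P c) (sgn b *\<^sub>R cross3 u m)"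
        unfolding y using const b by (intro support_face_add_multiple)
      then show "h c y = h c (sgn b *\<^sub>R cross3 u m)" by (simp add: h_def)
      have my: "- y = (- a) *\<^sub>R m + (- b) *\<^sub>R cross3 u m" by (simp add: y)
      have "support_face (support_face P c) (- y) = support_face (support_face P c) (sgn (- b) *\<^sub>R cross3 u m)"
        unfolding my by (rule support_face_add_multiple, erule (1) const, use b in simp)
      then show "h c (- y) = h c (- (sgn b *\<^sub>R cross3 u m))" by (simp add: h_def sgn_minus)
    qed
    have "sgn b = 1 \<or> sgn b = - 1" using b by (auto simp: sgn_if)
    then have \<tau>: "\<tau> y = \<tau> (cross3 u m)" unfolding \<tau>_def by (auto simp: hy)
    have ev: "\<forall>\<^sub>F s in at_right 0. support_face P (c + s *\<^sub>R z) = support_face (support_face P c) z" for c z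
      by (rule eventually_support_face_perturb[OF P])
    show "\<forall>\<^sub>F s in at_right 0. segment_count P u (cross3 u (u0 + s *\<^sub>R v)) +
        segment_count P u (cross3 u (u0 - s *\<^sub>R v)) = \<tau> (cross3 u m)"
      using ev[of m y] ev[of m "- y"] ev[of "- m" y] ev[of "- m" "- y"]
    proof eventually_elim
      case (elim s)
      have c: "cross3 u (u0 + s *\<^sub>R v) = m + s *\<^sub>R y" "cross3 u (u0 - s *\<^sub>R v) = m + s *\<^sub>R (- y)"
        "- (m + s *\<^sub>R y) = - m + s *\<^sub>R (- y)" "- (m + s *\<^sub>R (- y)) = - m + s *\<^sub>R y"
        by (simp_all add: m_def y_def cross_add_right Cross3.right_diff_distrib cross_mult_right)
      have "segment_count P u (m + s *\<^sub>R y) + segment_count P u (m + s *\<^sub>R (- y)) = \<tau> y"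
        unfolding segment_count_def unfolding c(3,4) elim \<tau>_def h_def by simp
      then show ?case using c(1,2) \<tau> by simp
    qed
  qed
qed

text \<open>Nearby faces are contained in the face of \<open>d\<close>. As this face is a segment of
  direction \<open>u\<close>, a functional orthogonal to \<open>u\<close> is constant on it and must
  be maximal on all of it.\<close>

lemma eventually_support_face_eq:
  assumes P: "polytope P" "P \<noteq> {}" and col: "collinear (support_face P d)"
    and s: "has_segment (support_face P d) u"
  shows "\<forall>\<^sub>F e in nhds d. e \<bullet> u = 0 \<longrightarrow> support_face P e = support_face P d"
  using eventually_support_face_subset[OF P(1)]
proof eventually_elim
  case (elim e)
  show ?case
  proof
    assume e: "e \<bullet> u = 0"
    have "e \<bullet> x = e \<bullet> y" if xy: "x \<in> support_face P d" "y \<in> support_face P d" for x y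
    proof -
      obtain c where "x - y = c *\<^sub>R u" using collinear_has_segment[OF col s xy] by blast
      then have "e \<bullet> (x - y) = 0" using e by simp
      then show ?thesis by (simp add: inner_diff_right)
    qed
    moreover obtain z where z: "z \<in> support_face P e" using support_face_nonempty[OF P] by blast
    ultimately have "e \<bullet> x = e \<bullet> z" if "x \<in> support_face P d" for x using elim that by blast
    then have "support_face P d \<subseteq> support_face P e" using z by (auto simp: support_face_def)
    then show "support_face P e = support_face P d" using elim by blast
  qed
qed

lemma eventually_has_segment_eq:
  assumes P: "polytope P" "P \<noteq> {}" and col: "collinear (support_face P d)"
  shows "\<forall>\<^sub>F e in nhds d. e \<bullet> u = 0 \<longrightarrow>
    has_segment (support_face P e) u = has_segment (support_face P d) u"
proof (cases "has_segment (support_face P d) u")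
  case True
  from eventually_support_face_eq[OF P col True] show ?thesis by eventually_elim simp
next
  case False
  from eventually_support_face_subset[OF P(1)] show ?thesis
  proof eventually_elim
    case (elim e)
    then show ?case using False unfolding has_segment_def by blast
  qed
qed

lemma eventually_segment_count_eq:
  assumes P: "polytope P" "P \<noteq> {}" and d: "generic_dir P d"
  shows "\<forall>\<^sub>F e in nhds d. e \<bullet> u = 0 \<longrightarrow> segment_count P u e = segment_count P u d"
proof -
  have col: "collinear (support_face P d)" "collinear (support_face P (- d))"
    using d by (simp_all add: generic_dir_def)
  have "filterlim uminus (nhds (- d)) (nhds d)"
    by (rule tendsto_minus[OF filterlim_ident])
  from eventually_compose_filterlim[OF eventually_has_segment_eq[OF P col(2), of u] this]
  have "\<forall>\<^sub>F e in nhds d. e \<bullet> u = 0 \<longrightarrow>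
    has_segment (support_face P (- e)) u = has_segment (support_face P (- d)) u" by simp
  with eventually_has_segment_eq[OF P col(1), of u] show ?thesis
    by eventually_elim (simp add: segment_count_def)
qed

section \<open>Constancy of the count for equiprojective polytopes\<close>

lemma face_eq_support_face:
  assumes "polytope P" "F face_of P" "F \<noteq> {}"
  shows "\<exists>d. F = support_face P d"
proof -
  have "F exposed_face_of P"
    using assms exposed_face_of_polyhedron[OF polytope_imp_polyhedron[OF assms(1)]] by blast
  then obtain d b where "P \<subseteq> {x. d \<bullet> x \<le> b}" "F = P \<inter> {x. d \<bullet> x = b}"
    by (auto simp: exposed_face_of_def)
  then have "F = support_face P d"
    using assms(3) by (auto simp: support_face_def intro: order_antisym)
  then show ?thesis by blast
qed

text \<open>A facet normal \<open>n\<close> excludes at most one small \<open>s\<close>, because it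
  is not orthogonal to both \<open>u\<close> and \<open>v\<close>. Otherwise \<open>n\<close> would
  be parallel to \<open>d\<close>, and the facet would be one of the collinear faces of
  \<open>d\<close> and \<open>- d\<close>.\<close>

lemma eventually_not_orth_to_facet:
  assumes P: "polytope P" "aff_dim P = 3" and d: "generic_dir P d" "d \<bullet> u = 0" and u: "norm u = 1"
    and v: "v = cross3 d u \<or> v = - cross3 d u"
  shows "\<forall>\<^sub>F s in at_right 0. \<forall>F. F facet_of P \<longrightarrow> \<not> plane_orth_to_facet (u + s *\<^sub>R v) F"
proof -
  have "\<forall>\<^sub>F s in at_right 0. \<not> plane_orth_to_facet (u + s *\<^sub>R v) F" if F: "F facet_of P" for F
  proof -
    have F2: "aff_dim F = 2" "F \<noteq> {}" using F P by (auto simp: facet_of_def)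
    then have FP: "F \<noteq> P" using P by auto
    obtain n where Fn: "F = support_face P n"
      using face_eq_support_face[OF P(1) facet_of_imp_face_of[OF F] F2(2)] by blast
    have n0: "n \<noteq> 0" using FP Fn by (auto simp: support_face_def)
    have orth: "n \<bullet> w = 0" if "plane_orth_to_facet w F" for w
    proof -
      have "n \<bullet> (x - y) = 0" if "x \<in> F" "y \<in> F" for x y
        using support_face_inner_eq[of x P n y] that by (simp add: Fn inner_diff_right)
      then have "span {x - y | x y. x \<in> F \<and> y \<in> F} \<subseteq> {x. n \<bullet> x = 0}"
        by (intro span_minimal subspace_hyperplane) blast
      then show ?thesis using that by (auto simp: plane_orth_to_facet_def)
    qed
    have ne: "n \<bullet> u \<noteq> 0 \<or> n \<bullet> v \<noteq> 0"
    proof (rule ccontr)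
      assume "\<not> ?thesis"
      then have nu: "n \<bullet> u = 0" "n \<bullet> cross3 d u = 0" using v by auto
      have "cross3 u (cross3 d u) = d" using d u by (simp add: Lagrange inner_commute norm_eq_1)
      moreover have "d \<noteq> 0" using d by (simp add: generic_dir_def)
      ultimately obtain c where c: "n = c *\<^sub>R d"
        using orthogonal_to_two_parallel_cross[OF nu] by auto
      have "c \<noteq> 0" using c n0 by auto
      then have "F = support_face P d \<or> F = support_face P (- d)"
        using support_face_scaleR[of c P d] support_face_scaleR[of "- c" P "- d"] Fn c
        by (cases "c > 0") auto
      then have "collinear F" using d by (auto simp: generic_dir_def)
      then show False using F2 by (simp add: collinear_aff_dim)
    qed
    \<comment> \<open>If \<open>n \<bullet> v = 0\<close>, the quotient is 0 by convention, and
      \<open>ne\<close> gives \<open>n \<bullet> u \<noteq> 0\<close>.\<close>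
    have "\<forall>\<^sub>F s in at_right (0::real). s \<noteq> - (n \<bullet> u) / (n \<bullet> v)"
      by (rule eventually_neq_at_within)
    then show ?thesis
    proof eventually_elim
      case (elim s)
      have "n \<bullet> u + s * (n \<bullet> v) \<noteq> 0"
      proof
        assume *: "n \<bullet> u + s * (n \<bullet> v) = 0"
        then have "n \<bullet> v \<noteq> 0" using ne by auto
        then show False using * elim by (simp add: field_simps)
      qed
      then show ?case using orth[of "u + s *\<^sub>R v"] by (auto simp: inner_add_right)
    qed
  qed
  then have "\<forall>\<^sub>F s in at_right 0. \<forall>F\<in>{F. F facet_of P}. \<not> plane_orth_to_facet (u + s *\<^sub>R v) F"
    by (intro eventually_ball_finite finite_polytope_facets P) auto
  then show ?thesis by simp
qed

text \<open>For \<open>d\<close> orthogonal to no other direction in \<open>U\<close>, the vertex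
  counts along \<open>u0 + s v\<close> and \<open>u0 - s v\<close> add up to \<open>2 * k\<close>.
  Directions other than \<open>u0\<close> contribute fixed numbers, and \<open>u0\<close>
  contributes twice its count at \<open>d\<close>. Every other generic \<open>d\<close> is a limit
  of such vectors, and the count is locally constant.\<close>

lemma equiprojective_segment_count_const:
  assumes kP: "k_equiprojective k P" and u0: "norm u0 = 1" "first_nonzero_pos u0"
  shows "\<exists>c. \<forall>d. generic_dir P d \<and> d \<bullet> u0 = 0 \<longrightarrow> segment_count P u0 d = c"
proof -
  have P: "polytope P" "aff_dim P = 3" using kP by (auto simp: k_equiprojective_def)
  then have Pne: "P \<noteq> {}" by auto
  have kw: "card {v. v extreme_point_of (proj_plane w ` P)} = k"
    if "w \<noteq> 0" "\<And>F. F facet_of P \<Longrightarrow> \<not> plane_orth_to_facet w F" for w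
    using kP that by (auto simp: k_equiprojective_def)
  \<comment> \<open>\<open>u0\<close> need not be an edge direction and is added so that its term
    can be split off the sum.\<close>
  define U where "U = insert u0 (edge_dirs P)"
  have U: "finite U" "edge_dirs P \<subseteq> U" "\<And>u. u \<in> U \<Longrightarrow> norm u = 1 \<and> first_nonzero_pos u"
    using u0 finite_edge_dirs[OF P(1)] by (auto simp: U_def edge_dirs_def)
  have cross: "cross3 u u0 \<noteq> 0" if "u \<in> U - {u0}" for u
  proof
    assume "cross3 u u0 = 0"
    moreover have "u0 \<noteq> 0" using u0 by auto
    ultimately obtain c where "u = c *\<^sub>R u0" using parallel_if_cross_eq_0 by blast
    then show False using normalized_parallel_eq[of u c u0] U(3)[of u] u0 that by auto
  qed
  define balanced where "balanced u T \<longleftrightarrow> (\<forall>v. v \<bullet> cross3 u u0 \<noteq> 0 \<longrightarrow> (\<forall>\<^sub>F s in at_right 0.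
    segment_count P u (cross3 u (u0 + s *\<^sub>R v)) + segment_count P u (cross3 u (u0 - s *\<^sub>R v)) = T))" for u T
  have "\<exists>T. balanced u T" if "u \<in> U - {u0}" for u
    unfolding balanced_def using segment_count_symmetric_sum[OF P(1) Pne _ cross[OF that]] U(3) that by blast
  then obtain T where "\<And>u. u \<in> U - {u0} \<Longrightarrow> balanced u (T u)" by metis
  then have T: "\<forall>\<^sub>F s in at_right 0. segment_count P u (cross3 u (u0 + s *\<^sub>R v)) +
      segment_count P u (cross3 u (u0 - s *\<^sub>R v)) = T u"
    if "u \<in> U - {u0}" "v \<bullet> cross3 u u0 \<noteq> 0" for u v
    using that unfolding balanced_def by blast
  have main: "2 * segment_count P u0 d + (\<Sum>u\<in>U - {u0}. T u) = 2 * k"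
    if d: "generic_dir P d" "d \<bullet> u0 = 0" and du: "\<And>u. u \<in> U - {u0} \<Longrightarrow> d \<bullet> u \<noteq> 0" for d
  proof -
    \<comment> \<open>This choice gives \<open>u0 \<times> v = d\<close>, so along
      \<open>u0 + s v\<close> and \<open>u0 - s v\<close> the term of \<open>u0\<close> is evaluated
      at multiples of \<open>d\<close>.\<close>
    define v where "v = cross3 d u0"
    have d0: "d \<noteq> 0" using d by (simp add: generic_dir_def)
    have u0v: "cross3 u0 v = d" using d u0 by (simp add: v_def Lagrange inner_commute norm_eq_1)
    have vu: "v \<bullet> cross3 u u0 \<noteq> 0" if "u \<in> U - {u0}" for u
    proof -
      have "v \<bullet> cross3 u u0 = (d \<bullet> u) * (u0 \<bullet> u0) - (d \<bullet> u0) * (u0 \<bullet> u)"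
        unfolding v_def by (simp add: cross3_simps)
      then show ?thesis using d(2) u0 du[OF that] by (simp add: norm_eq_1)
    qed
    have sum: "k = (\<Sum>u\<in>U. segment_count P u (cross3 u w))"
      if w: "w = u0 + t *\<^sub>R v" "t \<noteq> 0" and facets: "\<And>F. F facet_of P \<Longrightarrow> \<not> plane_orth_to_facet w F" for w t
    proof -
      have "w \<bullet> u0 = 1" using u0 by (simp add: w v_def inner_add_left dot_cross_self norm_eq_1)
      then have w0: "w \<noteq> 0" by auto
      have "cross3 u w \<noteq> 0" if u: "u \<in> U" for u
      proof (cases "u = u0")
        case True
        then show ?thesis using w(2) d0 by (simp add: w(1) cross_add_right cross_mult_right u0v)
      next
        case False
        then show ?thesis using u edge_dirs_cross_nonzero[OF P w0 facets] by (auto simp: U_def)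
      qed
      then show ?thesis using card_extreme_points_eq_sum[OF P w0 facets U] kw[OF w0 facets] by simp
    qed
    have "\<forall>\<^sub>F s in at_right 0. \<forall>u\<in>U - {u0}. segment_count P u (cross3 u (u0 + s *\<^sub>R v)) +
        segment_count P u (cross3 u (u0 - s *\<^sub>R v)) = T u"
      using U(1) T vu by (intro eventually_ball_finite) auto
    moreover have "\<forall>\<^sub>F s in at_right 0. \<forall>F. F facet_of P \<longrightarrow> \<not> plane_orth_to_facet (u0 + s *\<^sub>R v) F"
      by (rule eventually_not_orth_to_facet[OF P d u0(1)]) (simp add: v_def)
    moreover have "\<forall>\<^sub>F s in at_right 0. \<forall>F. F facet_of P \<longrightarrow> \<not> plane_orth_to_facet (u0 + s *\<^sub>R (- v)) F"
      by (rule eventually_not_orth_to_facet[OF P d u0(1)]) (simp add: v_def)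
    moreover have "\<forall>\<^sub>F s in at_right (0::real). s > 0" by (simp add: eventually_at_right_less)
    ultimately have "\<forall>\<^sub>F s in at_right (0::real). 2 * segment_count P u0 d + (\<Sum>u\<in>U - {u0}. T u) = 2 * k"
    proof eventually_elim
      case (elim s)
      have "2 * k = (\<Sum>u\<in>U. segment_count P u (cross3 u (u0 + s *\<^sub>R v))) +
          (\<Sum>u\<in>U. segment_count P u (cross3 u (u0 - s *\<^sub>R v)))"
        using sum[of "u0 + s *\<^sub>R v" s] sum[of "u0 - s *\<^sub>R v" "- s"] elim by simp
      also have "\<dots> = (\<Sum>u\<in>U. segment_count P u (cross3 u (u0 + s *\<^sub>R v)) +
          segment_count P u (cross3 u (u0 - s *\<^sub>R v)))"
        by (simp add: sum.distrib)
      also have "\<dots> = segment_count P u0 (cross3 u0 (u0 + s *\<^sub>R v)) +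
          segment_count P u0 (cross3 u0 (u0 - s *\<^sub>R v)) + (\<Sum>u\<in>U - {u0}. T u)"
        using U(1) elim(1) by (subst sum.remove[of _ u0]) (auto simp: U_def)
      also have "cross3 u0 (u0 + s *\<^sub>R v) = s *\<^sub>R d"
        by (simp add: cross_add_right cross_mult_right u0v)
      also have "cross3 u0 (u0 - s *\<^sub>R v) = (- s) *\<^sub>R d"
        by (simp add: Cross3.right_diff_distrib cross_mult_right u0v)
      finally show ?case using elim(4) by (simp add: segment_count_scaleR del: scaleR_minus_left)
    qed
    then show ?thesis by simp
  qed
  obtain B where B: "finite B" "\<And>d. d \<noteq> 0 \<Longrightarrow> \<not> generic_dir P d \<Longrightarrow> \<exists>b\<in>B. \<exists>c. d = c *\<^sub>R b"
    using finite_nongeneric_lines[OF P(1)] by blast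
  show ?thesis
  \<comment> \<open>The equation \<open>main\<close> solved for the count; it makes the subtraction
    and the halving exact.\<close>
  proof (intro exI[of _ "(2 * k - (\<Sum>u\<in>U - {u0}. T u)) div 2"] allI impI)
    fix d assume "generic_dir P d \<and> d \<bullet> u0 = 0"
    then have d: "generic_dir P d" "d \<bullet> u0 = 0" by auto
    then have d0: "d \<noteq> 0" by (simp add: generic_dir_def)
    \<comment> \<open>Within the plane orthogonal to \<open>u0\<close>, the vectors orthogonal to
      \<open>u\<close> are the multiples of \<open>cross3 u u0\<close>. Avoiding these lines meets
      the requirement of \<open>main\<close>.\<close>
    let ?N = "{x. u0 \<bullet> x = 0}" and ?B = "B \<union> (\<lambda>u. cross3 u u0) ` (U - {u0})"
    have "cross3 d (cross3 u0 d) = (d \<bullet> d) *\<^sub>R u0" using d by (simp add: Lagrange)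
    then have "cross3 d (cross3 u0 d) \<noteq> 0" using d0 u0 by auto
    then have "d \<in> closure {y \<in> ?N. y \<noteq> 0 \<and> (\<forall>b\<in>?B. \<nexists>c. y = c *\<^sub>R b)}"
      using d(2) B(1) U(1)
      by (intro closure_minus_lines[of _ _ "cross3 u0 d"] convex_hyperplane)
        (auto simp: inner_commute dot_cross_self)
    moreover obtain r where r: "r > 0"
      "\<And>e. dist e d < r \<Longrightarrow> e \<bullet> u0 = 0 \<Longrightarrow> segment_count P u0 e = segment_count P u0 d"
      using eventually_segment_count_eq[OF P(1) Pne d(1), of u0] unfolding eventually_nhds_metric by auto
    ultimately obtain e where e: "dist e d < r" "e \<bullet> u0 = 0" "e \<noteq> 0" "\<forall>b\<in>?B. \<nexists>c. e = c *\<^sub>R b"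
      unfolding closure_approachable by (force simp: inner_commute)
    have "generic_dir P e" using B(2)[OF e(3)] e(4) by blast
    moreover have "e \<bullet> u \<noteq> 0" if "u \<in> U - {u0}" for u
      using orthogonal_to_two_parallel_cross[OF _ e(2) cross[OF that]] e(4) that by blast
    ultimately have "2 * segment_count P u0 e + (\<Sum>u\<in>U - {u0}. T u) = 2 * k"
      using main e(2) by blast
    then show "segment_count P u0 d = (2 * k - (\<Sum>u\<in>U - {u0}. T u)) div 2"
      using r(2)[OF e(1,2)] by simp
  qed
qed

section \<open>Constancy of the count for polygons and line segments\<close>

lemma segment_count_eq_0: "\<not> has_segment P u \<Longrightarrow> segment_count P u d = 0"
  using support_face_subset[of P d] support_face_subset[of P "- d"]
  unfolding segment_count_def has_segment_def by auto

text \<open>The count is zero if \<open>u\<close> is not parallel to the plane of \<open>P\<close>.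
  Otherwise the component of \<open>d\<close> along the normal \<open>n\<close> has no effect, and
  only the sign of the other component could matter, which is non-zero for generic \<open>d\<close>.
  The count is invariant under that sign.\<close>

lemma polygon_segment_count_const:
  assumes P: "polytope P" "aff_dim P = 2" and u: "u \<noteq> 0"
  shows "\<exists>c. \<forall>d. generic_dir P d \<and> d \<bullet> u = 0 \<longrightarrow> segment_count P u d = c"
proof -
  obtain n r where n: "n \<noteq> 0" "P \<subseteq> {x. n \<bullet> x = r}"
    using aff_lowdim_subset_hyperplane[of P] P by auto
  have const: "n \<bullet> x = n \<bullet> y" if "x \<in> P" "y \<in> P" for x y using n that by auto
  show ?thesis
  proof (cases "n \<bullet> u = 0")
    case False
    have "\<not> has_segment P u"
    proof
      assume "has_segment P u"
      then obtain x y c where x: "x \<in> P" "y \<in> P" "x \<noteq> y" "x - y = c *\<^sub>R u"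
        by (auto simp: has_segment_def)
      have "n \<bullet> (x - y) = 0" using const[OF x(1,2)] by (simp add: inner_diff_right)
      then show False using x False by simp
    qed
    then show ?thesis using segment_count_eq_0 by blast
  next
    case True
    show ?thesis
    proof (intro exI[of _ "segment_count P u (cross3 u n)"] allI impI)
      fix d assume d: "generic_dir P d \<and> d \<bullet> u = 0"
      obtain a b where ab: "d = a *\<^sub>R n + b *\<^sub>R cross3 u n"
        using orthogonal_basis_decomposition[OF True n(1) u, of d] d by blast
      have b: "b \<noteq> 0"
      proof
        assume "b = 0"
        then have "d \<bullet> x = d \<bullet> y" if "x \<in> P" "y \<in> P" for x y using const[OF that] ab by simp
        then have "support_face P d = P" by (rule support_face_const)
        then have "collinear P" using d by (simp add: generic_dir_def)
        then show False using P by (simp add: collinear_aff_dim)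
      qed
      have "support_face P d = support_face P (sgn b *\<^sub>R cross3 u n)"
        unfolding ab by (rule support_face_add_multiple, erule (1) const, rule b)
      moreover have md: "- d = (- a) *\<^sub>R n + (- b) *\<^sub>R cross3 u n" by (simp add: ab)
      have "support_face P (- d) = support_face P (sgn (- b) *\<^sub>R cross3 u n)"
        unfolding md by (rule support_face_add_multiple, erule (1) const, use b in simp)
      ultimately have "segment_count P u d = segment_count P u (sgn b *\<^sub>R cross3 u n)"
        by (simp add: segment_count_def sgn_minus)
      also have "\<dots> = segment_count P u (cross3 u n)"
        using b by (intro segment_count_scaleR) (simp add: sgn_zero_iff)
      finally show "segment_count P u d = segment_count P u (cross3 u n)" .
    qed
  qed
qed

lemma line_segment_segment_count_const:
  assumes "collinear P"
  shows "\<exists>c. \<forall>d. d \<bullet> u = 0 \<longrightarrow> segment_count P u d = c"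
proof (cases "has_segment P u")
  case True
  have "support_face P d = P" if "d \<bullet> u = 0" for d
  proof (rule support_face_const)
    fix x y assume "x \<in> P" "y \<in> P"
    then obtain c where "x - y = c *\<^sub>R u" using collinear_has_segment[OF assms True] by blast
    then have "d \<bullet> (x - y) = 0" using that by simp
    then show "d \<bullet> x = d \<bullet> y" by (simp add: inner_diff_right)
  qed
  then have "segment_count P u d = 2" if "d \<bullet> u = 0" for d
    using that True by (simp add: segment_count_def)
  then show ?thesis by blast
next
  case False
  then show ?thesis using segment_count_eq_0 by blast
qed

lemma admissible_summand_segment_count_const:
  assumes "admissible_summand P" "norm u = 1" "first_nonzero_pos u"
  shows "\<exists>c. \<forall>d. generic_dir P d \<and> d \<bullet> u = 0 \<longrightarrow> segment_count P u d = c"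
  using assms(1) unfolding admissible_summand_def equiprojective_def
proof (elim disjE exE conjE)
  fix k assume "k_equiprojective k P"
  then show ?thesis using assms by (intro equiprojective_segment_count_const)
next
  assume "polytope P" "aff_dim P = 2"
  then show ?thesis using assms by (intro polygon_segment_count_const) auto
next
  assume "aff_dim P = 1"
  then have "collinear P" by (simp add: collinear_aff_dim)
  from line_segment_segment_count_const[OF this, of u] show ?thesis by blast
qed

lemma admissible_summandD:
  assumes "admissible_summand P"
  shows "polytope P" "P \<noteq> {}"
proof -
  have "polytope P \<and> (aff_dim P = 3 \<or> aff_dim P = 2 \<or> aff_dim P = 1)"
    using assms unfolding admissible_summand_def equiprojective_def k_equiprojective_def by blast
  then show "polytope P" "P \<noteq> {}" by auto
qed

subsection \<open>Aggregated cones\<close>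

text \<open>Vectors of the plane orthogonal to \<open>u\<close> that are close to \<open>d\<close>
  have the same face as \<open>d\<close>, so the cone contains a disc of that plane.\<close>

lemma edge_normal_cone:
  assumes P: "polytope P" "P \<noteq> {}" and u: "u \<noteq> 0"
    and col: "collinear (support_face P d)" and s: "has_segment (support_face P d) u"
  shows "aff_dim (normal_cone P (support_face P d)) = 2"
    and "normal_cone P (support_face P d) \<subseteq> orth_plane u"
proof -
  let ?N = "normal_cone P (support_face P d)"
  have N: "e \<in> ?N \<longleftrightarrow> support_face P d \<subseteq> support_face P e" for e
    by (simp add: normal_cone_iff support_face_subset)
  show sub: "?N \<subseteq> orth_plane u"
  proof
    fix e assume "e \<in> ?N"
    then have "has_segment (support_face P e) u" using N s unfolding has_segment_def by blast
    then show "e \<in> orth_plane u" using has_segment_orthogonal by (auto simp: orth_plane_def inner_commute)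
  qed
  obtain r where r: "r > 0" "\<And>e. dist e d < r \<Longrightarrow> e \<bullet> u = 0 \<Longrightarrow> support_face P e = support_face P d"
    using eventually_support_face_eq[OF P col s] unfolding eventually_nhds_metric by blast
  have plane: "aff_dim (orth_plane u) = 2" using u by (simp add: orth_plane_def)
  have "aff_dim (orth_plane u \<inter> ball d r) = aff_dim (orth_plane u)"
  proof (rule aff_dim_convex_Int_open)
    show "convex (orth_plane u)" unfolding orth_plane_def by (rule convex_hyperplane)
    have "d \<in> orth_plane u \<inter> ball d r"
      using r(1) has_segment_orthogonal[OF s] by (simp add: orth_plane_def inner_commute)
    then show "orth_plane u \<inter> ball d r \<noteq> {}" by blast
  qed simp
  moreover have "orth_plane u \<inter> ball d r \<subseteq> ?N"
    using r(2) N by (auto simp: orth_plane_def inner_commute dist_commute)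
  ultimately have "2 \<le> aff_dim ?N"
    using aff_dim_subset[of "orth_plane u \<inter> ball d r" ?N] plane by simp
  moreover have "aff_dim ?N \<le> 2" using aff_dim_subset[OF sub] plane by simp
  ultimately show "aff_dim ?N = 2" by simp
qed

lemma aggregated_coneI:
  assumes P: "polytope P" "P \<noteq> {}" and u: "u \<noteq> 0"
    and col: "collinear (support_face P d)" and s: "has_segment (support_face P d) u"
  shows "d \<in> aggregated_cone P u"
proof -
  have "d \<in> normal_cone P (support_face P d)" by (simp add: normal_cone_iff support_face_subset)
  moreover have "support_face P d face_of P" by (intro support_face_face_of polytope_imp_convex P)
  ultimately show ?thesis
    unfolding aggregated_cone_def using edge_normal_cone[OF assms] support_face_nonempty[OF P] by blast
qed

lemma aggregated_coneD:
  assumes P: "polytope P" "P \<noteq> {}" and u: "u \<noteq> 0" and d: "d \<in> aggregated_cone P u"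
  shows "has_segment (support_face P d) u"
proof -
  obtain F where F: "F face_of P" "F \<noteq> {}" "aff_dim (normal_cone P F) = 2"
    "normal_cone P F \<subseteq> orth_plane u" "d \<in> normal_cone P F"
    using d by (auto simp: aggregated_cone_def)
  have FP: "F \<subseteq> P" using F face_of_imp_subset by blast
  obtain e where e: "F = support_face P e" using face_eq_support_face[OF P(1) F(1,2)] by blast
  \<comment> \<open>The normal cone of a vertex contains a neighbourhood in space, which does not
    fit into a plane.\<close>
  obtain x y where x: "x \<in> F" "y \<in> F" "x \<noteq> y"
  proof (rule ccontr)
    assume "\<not> thesis"
    then have "\<And>x y. x \<in> F \<Longrightarrow> y \<in> F \<Longrightarrow> x = y" using that by blast
    then obtain v where v: "F = {v}" using F(2) by blast
    obtain r where r: "r > 0" "\<And>e'. dist e' e < r \<Longrightarrow> support_face P e' \<subseteq> F"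
      using eventually_support_face_subset[OF P(1), of e] e unfolding eventually_nhds_metric by blast
    have N: "e' \<in> orth_plane u" if "dist e' e < r" for e'
    proof -
      have "support_face P e' = F" using r(2)[OF that] v support_face_nonempty[OF P, of e'] by blast
      then have "e' \<in> normal_cone P F" by (simp add: normal_cone_iff FP)
      then show ?thesis using F(4) by blast
    qed
    have "u \<bullet> e = 0" using N[of e] r(1) by (simp add: orth_plane_def)
    moreover have "u \<bullet> (e + (r / (2 * norm u)) *\<^sub>R u) = 0"
      using N[of "e + (r / (2 * norm u)) *\<^sub>R u"] r(1) u by (simp add: orth_plane_def dist_norm)
    ultimately show False using r(1) u by (simp add: inner_add_right)
  qed
  \<comment> \<open>Otherwise orthogonality to both \<open>x - y\<close> and \<open>u\<close> would
    force the cone into a line.\<close>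
  have "cross3 (x - y) u = 0"
  proof (rule ccontr)
    assume c: "cross3 (x - y) u \<noteq> 0"
    have "\<exists>c. e' = c *\<^sub>R cross3 (x - y) u" if "e' \<in> normal_cone P F" for e'
    proof (rule orthogonal_to_two_parallel_cross[OF _ _ c])
      have "F \<subseteq> support_face P e'" using that normal_cone_iff[OF FP] by blast
      then have "e' \<bullet> x = e' \<bullet> y" using support_face_inner_eq[of x P e' y] x by blast
      then show "e' \<bullet> (x - y) = 0" by (simp add: inner_diff_right)
      show "e' \<bullet> u = 0" using that F(4) by (auto simp: orth_plane_def inner_commute)
    qed
    then have "\<exists>c. e1 - e2 = c *\<^sub>R cross3 (x - y) u"
      if "e1 \<in> normal_cone P F" "e2 \<in> normal_cone P F" for e1 e2
      using that by (metis scaleR_diff_left)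
    then have "collinear (normal_cone P F)" unfolding collinear_def by blast
    then show False using F(3) by (simp add: collinear_aff_dim)
  qed
  then obtain c where "x - y = c *\<^sub>R u" using parallel_if_cross_eq_0 u by blast
  moreover have "F \<subseteq> support_face P d" using F(5) normal_cone_iff[OF FP] by blast
  ultimately show ?thesis using x unfolding has_segment_def by blast
qed

text \<open>Genericity serves the backward implication: the normal of a facet sees segments of
  directions in which the facet has no edge.\<close>

lemma aggregated_cone_generic:
  assumes "polytope P" "P \<noteq> {}" "u \<noteq> 0" "generic_dir P d"
  shows "d \<in> aggregated_cone P u \<longleftrightarrow> has_segment (support_face P d) u"
  using assms aggregated_coneI aggregated_coneD by (metis generic_dir_def)

section \<open>Recovering cones from their generic vectors\<close>

lemma closed_aggregated_cone:
  assumes "polytope P"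
  shows "closed (aggregated_cone P u)"
proof -
  have "aggregated_cone P u = \<Union>(normal_cone P ` {F. F face_of P \<and> F \<noteq> {} \<and>
       aff_dim (normal_cone P F) = 2 \<and> normal_cone P F \<subseteq> orth_plane u})"
    by (auto simp: aggregated_cone_def)
  moreover have "finite {F. F face_of P \<and> F \<noteq> {} \<and>
       aff_dim (normal_cone P F) = 2 \<and> normal_cone P F \<subseteq> orth_plane u}"
    using finite_polytope_faces[OF assms] by simp
  ultimately show ?thesis by (simp add: closed_UN closed_normal_cone)
qed

text \<open>Generic vectors are dense in a two-dimensional convex set, since the others lie on
  finitely many lines through the origin.\<close>

lemma subset_closed_if_generic:
  assumes R: "polytope R" and N: "convex N" "aff_dim N = 2" and X: "closed X"
    and gen: "\<And>d. d \<in> N \<Longrightarrow> generic_dir R d \<Longrightarrow> d \<in> X"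
  shows "N \<subseteq> X"
proof -
  obtain B where B: "finite B" "\<And>d. d \<noteq> 0 \<Longrightarrow> \<not> generic_dir R d \<Longrightarrow> \<exists>b\<in>B. \<exists>c. d = c *\<^sub>R b"
    using finite_nongeneric_lines[OF R] by blast
  have nz: "x \<in> X" if x: "x \<in> N - {0}" for x
  proof -
    have "\<exists>z\<in>N. cross3 z x \<noteq> 0"
    proof (rule ccontr)
      assume "\<not> ?thesis"
      then have "\<exists>c. z = c *\<^sub>R x" if "z \<in> N" for z using parallel_if_cross_eq_0 x that by blast
      then have "\<exists>c. z1 - z2 = c *\<^sub>R x" if "z1 \<in> N" "z2 \<in> N" for z1 z2
        using that by (metis scaleR_diff_left)
      then have "collinear N" unfolding collinear_def by blast
      then show False using N(2) by (simp add: collinear_aff_dim)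
    qed
    then obtain z where z: "z \<in> N" "cross3 x z \<noteq> 0" using cross_skew by (metis neg_0_equal_iff_equal)
    have "x \<in> closure {y \<in> N. y \<noteq> 0 \<and> (\<forall>b\<in>B. \<nexists>c. y = c *\<^sub>R b)}"
      using x z by (intro closure_minus_lines N B) auto
    also have "\<dots> \<subseteq> X" using gen B(2) by (intro closure_minimal X) blast
    finally show ?thesis .
  qed
  \<comment> \<open>No vector is independent of the origin, which is instead reached as a limit of
    the other points of \<open>N\<close>.\<close>
  have "0 \<in> X" if "0 \<in> N"
  proof -
    have "N \<noteq> {x}" for x using N(2) by auto
    then have "0 islimpt N" by (rule connected_imp_perfect[OF convex_connected[OF N(1)] that])
    then have "0 \<in> closure (N - {0})" by (simp add: islimpt_in_closure)
    also have "\<dots> \<subseteq> X" using nz by (intro closure_minimal X) blast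
    finally show ?thesis .
  qed
  then show ?thesis using nz by blast
qed

lemma aggregated_cone_subset_orth_plane: "aggregated_cone P u \<subseteq> orth_plane u"
  by (auto simp: aggregated_cone_def)

lemma aggregated_cone_orthogonal: "d \<in> aggregated_cone P u \<Longrightarrow> d \<bullet> u = 0"
  by (auto simp: aggregated_cone_def orth_plane_def inner_commute)

lemma aggregated_cone_subset_closed:
  assumes "polytope R" "closed X"
    and "\<And>d. d \<in> aggregated_cone P u \<Longrightarrow> generic_dir R d \<Longrightarrow> d \<in> X"
  shows "aggregated_cone P u \<subseteq> X"
proof -
  have "normal_cone P F \<subseteq> X" if "F face_of P" "F \<noteq> {}" "aff_dim (normal_cone P F) = 2"
    "normal_cone P F \<subseteq> orth_plane u" for F
    by (rule subset_closed_if_generic[OF assms(1) convex_normal_cone _ assms(2,3)])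
      (use that in \<open>auto simp: aggregated_cone_def\<close>)
  then show ?thesis unfolding aggregated_cone_def by blast
qed

lemma orth_plane_subset_closed:
  assumes "polytope R" "closed X" "u \<noteq> 0" "\<And>d. d \<bullet> u = 0 \<Longrightarrow> generic_dir R d \<Longrightarrow> d \<in> X"
  shows "orth_plane u \<subseteq> X"
proof (rule subset_closed_if_generic[OF assms(1) _ _ assms(2)])
  show "convex (orth_plane u)" unfolding orth_plane_def by (rule convex_hyperplane)
  show "aff_dim (orth_plane u) = 2" using assms(3) by (simp add: orth_plane_def)
  show "d \<in> X" if "d \<in> orth_plane u" "generic_dir R d" for d
    using that assms(4) by (simp add: orth_plane_def inner_commute)
qed

text \<open>The vector found is generic for a second polytope \<open>R\<close>, later the Minkowski
  sum. It exists because otherwise the density argument, applied to the empty closed set, would make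
  the cone empty.\<close>

lemma edge_direction_imp_generic:
  assumes P: "polytope P" "P \<noteq> {}" and R: "polytope R" and u: "edge_direction P u"
  shows "\<exists>d. generic_dir R d \<and> d \<bullet> u = 0 \<and> d \<in> aggregated_cone P u"
proof -
  obtain E a b c where E: "E edge_of P" "a extreme_point_of E" "b extreme_point_of E" "a \<noteq> b"
    "a - b = c *\<^sub>R u" using u by (auto simp: edge_direction_def)
  have u0: "u \<noteq> 0" using u by (auto simp: edge_direction_def)
  have E1: "E face_of P" "aff_dim E = 1" using E by (auto simp: edge_of_def)
  have ab: "a \<in> E" "b \<in> E" using E by (auto simp: extreme_point_of_def)
  then obtain e where e: "E = support_face P e" using face_eq_support_face[OF P(1) E1(1)] by blast
  have "has_segment (support_face P e) u" using ab E e by (auto simp: has_segment_def)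
  moreover have "collinear (support_face P e)" using e E1 by (simp add: collinear_aff_dim)
  ultimately have "e \<in> aggregated_cone P u" by (intro aggregated_coneI P u0)
  then have "\<not> aggregated_cone P u \<subseteq> {}" by blast
  then obtain d where d: "d \<in> aggregated_cone P u" "generic_dir R d"
    using aggregated_cone_subset_closed[OF R closed_empty] by blast
  then show ?thesis using aggregated_cone_orthogonal by blast
qed

text \<open>A collinear face with two points is an edge, and Krein-Milman supplies two distinct
  extreme points of it.\<close>

lemma edge_directionI:
  assumes P: "polytope P" and u: "norm u = 1" "first_nonzero_pos u"
    and col: "collinear (support_face P d)" and s: "has_segment (support_face P d) u"
  shows "edge_direction P u"
proof -
  let ?F = "support_face P d"
  have F: "polytope ?F" by (rule polytope_support_face[OF P])
  have face: "?F face_of P" by (intro support_face_face_of polytope_imp_convex P)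
  obtain x y where xy: "x \<in> ?F" "y \<in> ?F" "x \<noteq> y" using s by (auto simp: has_segment_def)
  have "aff_dim ?F \<le> 1" using col by (simp add: collinear_aff_dim)
  moreover have "\<not> aff_dim ?F \<le> 0"
  proof
    assume "aff_dim ?F \<le> 0"
    then have "aff_dim {x, y} \<le> 0" using aff_dim_subset[of "{x, y}" ?F] xy by simp
    then show False using xy by simp
  qed
  ultimately have "?F edge_of P" using face by (simp add: edge_of_def)
  moreover obtain a b where ab: "a extreme_point_of ?F" "b extreme_point_of ?F" "a \<noteq> b"
  proof (rule ccontr)
    assume "\<not> thesis"
    then have "\<And>a b. a extreme_point_of ?F \<Longrightarrow> b extreme_point_of ?F \<Longrightarrow> a = b" using that by blast
    then obtain a where "{a. a extreme_point_of ?F} \<subseteq> {a}" by blast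
    then have "convex hull {a. a extreme_point_of ?F} \<subseteq> {a}" by (intro hull_minimal) auto
    then have "?F \<subseteq> {a}"
      using Krein_Milman_Minkowski[OF polytope_imp_compact[OF F] polytope_imp_convex[OF F]] by simp
    then show False using xy by blast
  qed
  moreover have "\<exists>c. a - b = c *\<^sub>R u"
    using ab by (intro collinear_has_segment[OF col s]) (auto simp: extreme_point_of_def)
  ultimately show ?thesis using u unfolding edge_direction_def by blast
qed

subsection \<open>Minkowski sums\<close>

lemma polytope_minkowski_sum:
  assumes "polytope P" "polytope Q"
  shows "polytope (minkowski_sum P Q)"
proof -
  have "minkowski_sum P Q = (\<lambda>(x, y). x + y) ` (P \<times> Q)" by (auto simp: minkowski_sum_def)
  moreover have "linear (\<lambda>(x, y). x + y :: R3)"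
    by (rule linearI) (auto simp: algebra_simps)
  ultimately show ?thesis using polytope_linear_image polytope_Times assms by metis
qed

lemma minkowski_sum_commute: "minkowski_sum P Q = minkowski_sum Q P"
  by (auto simp: minkowski_sum_def) (metis add.commute)+

lemma collinear_minkowski_sum:
  assumes "collinear (minkowski_sum S T)" "T \<noteq> {}"
  shows "collinear S"
proof -
  obtain t where t: "t \<in> T" using assms by blast
  obtain e where e: "\<And>x y. x \<in> minkowski_sum S T \<Longrightarrow> y \<in> minkowski_sum S T \<Longrightarrow> \<exists>c. x - y = c *\<^sub>R e"
    using assms(1) unfolding collinear_def by blast
  have "\<exists>c. x - y = c *\<^sub>R e" if "x \<in> S" "y \<in> S" for x y
  proof -
    have "x + t \<in> minkowski_sum S T" "y + t \<in> minkowski_sum S T"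
      using that t by (auto simp: minkowski_sum_def)
    from e[OF this] show ?thesis by simp
  qed
  then show ?thesis unfolding collinear_def by blast
qed

lemma generic_dir_minkowski_sum:
  assumes "polytope Q" "Q \<noteq> {}" "generic_dir (minkowski_sum P Q) d"
  shows "generic_dir P d"
  using assms collinear_minkowski_sum support_face_nonempty
  unfolding generic_dir_def support_face_minkowski_sum by blast

text \<open>Changing one summand at a time stays in the sum, where all differences are multiples of
  \<open>u\<close>; so a summand that really changes contains a segment of direction
  \<open>u\<close>. Without collinearity, two segments could add up to a parallelogram with new
  directions.\<close>

lemma has_segment_minkowski_sum:
  assumes col: "collinear (minkowski_sum S T)" and ne: "S \<noteq> {}" "T \<noteq> {}"
  shows "has_segment (minkowski_sum S T) u \<longleftrightarrow> has_segment S u \<or> has_segment T u"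
proof
  assume s: "has_segment (minkowski_sum S T) u"
  then obtain a b a' b' where ab: "a \<in> S" "a' \<in> S" "b \<in> T" "b' \<in> T" "a + b \<noteq> a' + b'"
    unfolding has_segment_def minkowski_sum_def by blast
  then have m: "a + b \<in> minkowski_sum S T" "a' + b \<in> minkowski_sum S T" "a + b' \<in> minkowski_sum S T"
    by (auto simp: minkowski_sum_def)
  show "has_segment S u \<or> has_segment T u"
  proof (cases "a = a'")
    case False
    then show ?thesis using collinear_has_segment[OF col s m(1,2)] ab by (auto simp: has_segment_def)
  next
    case True
    then have "b \<noteq> b'" using ab by auto
    moreover have "\<exists>c. b - b' = c *\<^sub>R u" using collinear_has_segment[OF col s m(1,3)] by simp
    ultimately show ?thesis using ab unfolding has_segment_def by blast
  qed
next
  obtain p q where p: "p \<in> S" "q \<in> T" using ne by blast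
  assume "has_segment S u \<or> has_segment T u"
  then show "has_segment (minkowski_sum S T) u"
  proof
    assume "has_segment S u"
    then obtain x y c where x: "x \<in> S" "y \<in> S" "x \<noteq> y" "x - y = c *\<^sub>R u" by (auto simp: has_segment_def)
    then have "x + q \<in> minkowski_sum S T" "y + q \<in> minkowski_sum S T" "(x + q) - (y + q) = c *\<^sub>R u"
      "x + q \<noteq> y + q" using p by (auto simp: minkowski_sum_def)
    then show ?thesis unfolding has_segment_def by blast
  next
    assume "has_segment T u"
    then obtain x y c where x: "x \<in> T" "y \<in> T" "x \<noteq> y" "x - y = c *\<^sub>R u" by (auto simp: has_segment_def)
    then have "p + x \<in> minkowski_sum S T" "p + y \<in> minkowski_sum S T" "(p + x) - (p + y) = c *\<^sub>R u"
      "p + x \<noteq> p + y" using p by (auto simp: minkowski_sum_def)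
    then show ?thesis unfolding has_segment_def by blast
  qed
qed

text \<open>The vertex count is a sum of terms at \<open>u \<times> w\<close>, which is generic and
  orthogonal to \<open>u\<close> for every admissible \<open>w\<close>. The constants therefore add
  up to the required \<open>k\<close>.\<close>

lemma equiprojective_if_segment_count_const:
  assumes R: "polytope R" "aff_dim R = 3"
    and const: "\<And>u. norm u = 1 \<Longrightarrow> first_nonzero_pos u \<Longrightarrow>
      \<exists>c. \<forall>d. generic_dir R d \<and> d \<bullet> u = 0 \<longrightarrow> segment_count R u d = c"
  shows "equiprojective R"
proof -
  have "\<forall>u\<in>edge_dirs R. \<exists>c. \<forall>d. generic_dir R d \<and> d \<bullet> u = 0 \<longrightarrow> segment_count R u d = c"
    using const by (auto simp: edge_dirs_def)
  from bchoice[OF this] obtain c where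
    c: "\<forall>u\<in>edge_dirs R. \<forall>d. generic_dir R d \<and> d \<bullet> u = 0 \<longrightarrow> segment_count R u d = c u" by blast
  have "k_equiprojective (\<Sum>u\<in>edge_dirs R. c u) R"
    unfolding k_equiprojective_def
  proof (intro conjI allI impI R)
    fix w assume "w \<noteq> 0 \<and> (\<forall>F. F facet_of R \<longrightarrow> \<not> plane_orth_to_facet w F)"
    then have w: "w \<noteq> 0" "\<And>F. F facet_of R \<Longrightarrow> \<not> plane_orth_to_facet w F" by auto
    show "polytope (proj_plane w ` R)" by (intro polytope_linear_image linear_proj_plane R)
    show "aff_dim (proj_plane w ` R) = 2" by (intro aff_dim_proj_plane R w)
    have cr: "cross3 u w \<noteq> 0" if "u \<in> edge_dirs R" for u
      by (rule edge_dirs_cross_nonzero[OF R w that])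
    have "card {v. v extreme_point_of (proj_plane w ` R)} =
        (\<Sum>u\<in>edge_dirs R. segment_count R u (cross3 u w))"
      by (rule card_extreme_points_eq_sum[OF R w finite_edge_dirs[OF R(1)] order_refl _ cr])
        (auto simp: edge_dirs_def)
    also have "\<dots> = (\<Sum>u\<in>edge_dirs R. c u)"
    proof (rule sum.cong[OF refl])
      fix u assume u: "u \<in> edge_dirs R"
      have "generic_dir R (cross3 u w)"
        by (rule generic_dir_if_orth[OF R w cr[OF u]]) (simp_all add: dot_cross_self)
      then show "segment_count R u (cross3 u w) = c u" using c u by (simp add: dot_cross_self)
    qed
    finally show "card {v. v extreme_point_of (proj_plane w ` R)} = (\<Sum>u\<in>edge_dirs R. c u)" .
  qed
  then show ?thesis unfolding equiprojective_def by blast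
qed

section \<open>Comparing the cones of the two summands\<close>

theorem theorem4p3:
  fixes P Q :: "(real ^ 3) set"
  assumes "admissible_summand P" and "admissible_summand Q"
    and "aff_dim (minkowski_sum P Q) = 3"
  shows "equiprojective (minkowski_sum P Q) \<longleftrightarrow>
    (\<forall>u. edge_direction P u \<and> edge_direction Q u \<longrightarrow>
       (aggregated_cone P u = orth_plane u \<or> aggregated_cone Q u = orth_plane u) \<or>
       (aggregated_cone P u = aggregated_cone Q u \<or>
        aggregated_cone P u = uminus ` aggregated_cone Q u))"
proof -
  define R where "R = minkowski_sum P Q"
  note P = admissible_summandD[OF assms(1)] and Q = admissible_summandD[OF assms(2)]
  have R: "polytope R" "aff_dim R = 3"
    using polytope_minkowski_sum[OF P(1) Q(1)] assms(3) by (simp_all add: R_def)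
  define p where "p u d = has_segment (support_face P d) u" for u d
  define q where "q u d = has_segment (support_face Q d) u" for u d
  \<comment> \<open>Vectors generic for the sum are generic for both summands, so all three counts
    can be compared at the same vectors.\<close>
  have gP: "generic_dir P d" if "generic_dir R d" for d
    using generic_dir_minkowski_sum[OF Q] that unfolding R_def .
  have gQ: "generic_dir Q d" if "generic_dir R d" for d
    using generic_dir_minkowski_sum[OF P] that unfolding R_def minkowski_sum_commute[of P Q] .
  have r: "has_segment (support_face R d) u \<longleftrightarrow> p u d \<or> q u d" if "generic_dir R d" for u d
    using that has_segment_minkowski_sum[OF _ support_face_nonempty[OF P] support_face_nonempty[OF Q]]
    unfolding R_def generic_dir_def support_face_minkowski_sum p_def q_def by blast
  have cntR: "segment_count R u d = of_bool (p u d \<or> q u d) + of_bool (p u (- d) \<or> q u (- d))"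
    if "generic_dir R d" for u d
    unfolding segment_count_def r[OF that] r[OF generic_dir_minus[OF that]] ..
  have cntP: "segment_count P u d = of_bool (p u d) + of_bool (p u (- d))"
    and cntQ: "segment_count Q u d = of_bool (q u d) + of_bool (q u (- d))" for u d
    by (simp_all add: segment_count_def p_def q_def)
  have aP: "d \<in> aggregated_cone P u \<longleftrightarrow> p u d" and aQ: "d \<in> aggregated_cone Q u \<longleftrightarrow> q u d"
    if "generic_dir R d" "u \<noteq> 0" for u d
    using aggregated_cone_generic[OF P that(2) gP[OF that(1)]]
      aggregated_cone_generic[OF Q that(2) gQ[OF that(1)]] by (simp_all add: p_def q_def)
  have constP: "\<exists>c. \<forall>d. generic_dir R d \<and> d \<bullet> u = 0 \<longrightarrow> segment_count P u d = c"
    if u: "norm u = 1" "first_nonzero_pos u" for u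
  proof -
    obtain c where "\<forall>d. generic_dir P d \<and> d \<bullet> u = 0 \<longrightarrow> segment_count P u d = c"
      using admissible_summand_segment_count_const[OF assms(1) u] ..
    then have "\<forall>d. generic_dir R d \<and> d \<bullet> u = 0 \<longrightarrow> segment_count P u d = c" using gP by simp
    then show ?thesis ..
  qed
  have constQ: "\<exists>c. \<forall>d. generic_dir R d \<and> d \<bullet> u = 0 \<longrightarrow> segment_count Q u d = c"
    if u: "norm u = 1" "first_nonzero_pos u" for u
  proof -
    obtain c where "\<forall>d. generic_dir Q d \<and> d \<bullet> u = 0 \<longrightarrow> segment_count Q u d = c"
      using admissible_summand_segment_count_const[OF assms(2) u] ..
    then have "\<forall>d. generic_dir R d \<and> d \<bullet> u = 0 \<longrightarrow> segment_count Q u d = c" using gQ by simp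
    then show ?thesis ..
  qed
  show ?thesis
    unfolding R_def[symmetric]
  proof (intro iffI allI impI)
    fix u assume "equiprojective R" and "edge_direction P u \<and> edge_direction Q u"
    then have eP: "edge_direction P u" and eQ: "edge_direction Q u" by auto
    then have u: "norm u = 1" "first_nonzero_pos u" by (auto simp: edge_direction_def)
    then have u0: "u \<noteq> 0" by auto
    obtain k where "k_equiprojective k R" using \<open>equiprojective R\<close> unfolding equiprojective_def ..
    then obtain cR where cR: "\<And>d. generic_dir R d \<Longrightarrow> d \<bullet> u = 0 \<Longrightarrow> segment_count R u d = cR"
      using equiprojective_segment_count_const[OF _ u] by metis
    obtain cP where cP: "\<And>d. generic_dir R d \<Longrightarrow> d \<bullet> u = 0 \<Longrightarrow> segment_count P u d = cP"
      using constP[OF u] by metis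
    obtain cQ where cQ: "\<And>d. generic_dir R d \<Longrightarrow> d \<bullet> u = 0 \<Longrightarrow> segment_count Q u d = cQ"
      using constQ[OF u] by metis
    obtain dP where dP: "generic_dir R dP" "dP \<bullet> u = 0" "p u dP"
      using edge_direction_imp_generic[OF P R(1) eP] aP[OF _ u0] by blast
    obtain dQ where dQ: "generic_dir R dQ" "dQ \<bullet> u = 0" "q u dQ"
      using edge_direction_imp_generic[OF Q R(1) eQ] aQ[OF _ u0] by blast
    have cP1: "cP \<ge> 1" using cP[OF dP(1,2)] dP(3) by (simp add: cntP)
    have cQ1: "cQ \<ge> 1" using cQ[OF dQ(1,2)] dQ(3) by (simp add: cntQ)
    show "(aggregated_cone P u = orth_plane u \<or> aggregated_cone Q u = orth_plane u) \<or>
       (aggregated_cone P u = aggregated_cone Q u \<or>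
        aggregated_cone P u = uminus ` aggregated_cone Q u)"
    proof (cases "(\<forall>d. generic_dir R d \<and> d \<bullet> u = 0 \<longrightarrow> p u d) \<or> (\<forall>d. generic_dir R d \<and> d \<bullet> u = 0 \<longrightarrow> q u d)")
      case True
      \<comment> \<open>One closed cone contains all generic vectors of the plane, hence the whole
        plane.\<close>
      then have "orth_plane u \<subseteq> aggregated_cone P u \<or> orth_plane u \<subseteq> aggregated_cone Q u"
        using orth_plane_subset_closed[OF R(1) closed_aggregated_cone[OF P(1)] u0]
          orth_plane_subset_closed[OF R(1) closed_aggregated_cone[OF Q(1)] u0] aP[OF _ u0] aQ[OF _ u0] by blast
      then show ?thesis using aggregated_cone_subset_orth_plane by blast
    next
      case False
      then obtain d1 d2 where d1: "generic_dir R d1" "d1 \<bullet> u = 0" "\<not> p u d1"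
        and d2: "generic_dir R d2" "d2 \<bullet> u = 0" "\<not> q u d2" by blast
      have "cP \<le> 1" using cP[OF d1(1,2)] d1(3) by (auto simp: cntP)
      moreover have "cQ \<le> 1" using cQ[OF d2(1,2)] d2(3) by (auto simp: cntQ)
      \<comment> \<open>Each cone now contains exactly one of \<open>d\<close> and
        \<open>- d\<close>, for every generic \<open>d\<close> in the plane.\<close>
      ultimately have c1: "cP = 1" "cQ = 1" using cP1 cQ1 by auto
      have pm: "p u (- d) \<longleftrightarrow> \<not> p u d" if "generic_dir R d" "d \<bullet> u = 0" for d
        using cP[OF that] unfolding c1 cntP by (cases "p u d"; cases "p u (- d)") simp_all
      have qm: "q u (- d) \<longleftrightarrow> \<not> q u d" if "generic_dir R d" "d \<bullet> u = 0" for d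
        using cQ[OF that] unfolding c1 cntQ by (cases "q u d"; cases "q u (- d)") simp_all
      have clP: "closed (aggregated_cone P u)" and clQ: "closed (aggregated_cone Q u)"
        by (intro closed_aggregated_cone P Q)+
      have orth: "d \<bullet> u = 0" if "d \<in> aggregated_cone P u \<or> d \<in> aggregated_cone Q u" for d
        using that aggregated_cone_orthogonal by blast
      show ?thesis
      \<comment> \<open>At a generic vector the union has count 1 where the cones agree and 2 where
        they differ. As this count is constant, they agree at every generic vector or differ at
        every one; differing means being opposite.\<close>
      proof (cases "cR = 2")
        case True
        have qp: "q u d \<longleftrightarrow> p u (- d)" if "generic_dir R d" "d \<bullet> u = 0" for d
          using cR[OF that] unfolding True cntR[OF that(1)] pm[OF that] qm[OF that]
          by (cases "p u d"; cases "q u d") simp_all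
        have "aggregated_cone P u \<subseteq> uminus ` aggregated_cone Q u"
        proof (rule aggregated_cone_subset_closed[OF R(1) closed_negations[OF clQ]])
          fix d assume d: "d \<in> aggregated_cone P u" "generic_dir R d"
          then have "q u (- d)" using aP[OF d(2) u0] qp[OF d(2)] pm[OF d(2)] qm[OF d(2)] orth by blast
          then have "- d \<in> aggregated_cone Q u" using aQ[OF generic_dir_minus[OF d(2)] u0] by blast
          then show "d \<in> uminus ` aggregated_cone Q u" by (metis imageI minus_minus)
        qed
        moreover have "aggregated_cone Q u \<subseteq> uminus ` aggregated_cone P u"
        proof (rule aggregated_cone_subset_closed[OF R(1) closed_negations[OF clP]])
          fix d assume d: "d \<in> aggregated_cone Q u" "generic_dir R d"
          then have "p u (- d)" using aQ[OF d(2) u0] qp[OF d(2)] orth by blast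
          then have "- d \<in> aggregated_cone P u" using aP[OF generic_dir_minus[OF d(2)] u0] by blast
          then show "d \<in> uminus ` aggregated_cone P u" by (metis imageI minus_minus)
        qed
        ultimately have "aggregated_cone P u = uminus ` aggregated_cone Q u" by force
        then show ?thesis by blast
      next
        case False
        have qp: "q u d \<longleftrightarrow> p u d" if "generic_dir R d" "d \<bullet> u = 0" for d
          using cR[OF that] False unfolding cntR[OF that(1)] pm[OF that] qm[OF that]
          by (cases "p u d"; cases "q u d") simp_all
        have "aggregated_cone P u \<subseteq> aggregated_cone Q u"
          using aP[OF _ u0] aQ[OF _ u0] qp orth by (intro aggregated_cone_subset_closed[OF R(1) clQ]) blast
        moreover have "aggregated_cone Q u \<subseteq> aggregated_cone P u"
          using aP[OF _ u0] aQ[OF _ u0] qp orth by (intro aggregated_cone_subset_closed[OF R(1) clP]) blast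
        ultimately show ?thesis by blast
      qed
    qed
  next
    assume cond: "\<forall>u. edge_direction P u \<and> edge_direction Q u \<longrightarrow>
       (aggregated_cone P u = orth_plane u \<or> aggregated_cone Q u = orth_plane u) \<or>
       (aggregated_cone P u = aggregated_cone Q u \<or>
        aggregated_cone P u = uminus ` aggregated_cone Q u)"
    show "equiprojective R"
    proof (rule equiprojective_if_segment_count_const[OF R])
      fix u :: R3 assume u: "norm u = 1" "first_nonzero_pos u"
      then have u0: "u \<noteq> 0" by auto
      obtain cP where cP: "\<And>d. generic_dir R d \<Longrightarrow> d \<bullet> u = 0 \<Longrightarrow> segment_count P u d = cP"
        using constP[OF u] by metis
      obtain cQ where cQ: "\<And>d. generic_dir R d \<Longrightarrow> d \<bullet> u = 0 \<Longrightarrow> segment_count Q u d = cQ"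
        using constQ[OF u] by metis
      have noP: "\<not> p u d" if "\<not> edge_direction P u" "generic_dir R d" for d
        using edge_directionI[OF P(1) u] gP[OF that(2)] that(1) by (auto simp: p_def generic_dir_def)
      have noQ: "\<not> q u d" if "\<not> edge_direction Q u" "generic_dir R d" for d
        using edge_directionI[OF Q(1) u] gQ[OF that(2)] that(1) by (auto simp: q_def generic_dir_def)
      consider "\<not> edge_direction P u" | "\<not> edge_direction Q u"
        | "aggregated_cone P u = orth_plane u \<or> aggregated_cone Q u = orth_plane u"
        | "aggregated_cone P u = aggregated_cone Q u"
        | "aggregated_cone P u = uminus ` aggregated_cone Q u"
        using cond by blast
      then have "\<exists>c. \<forall>d. generic_dir R d \<longrightarrow> d \<bullet> u = 0 \<longrightarrow> segment_count R u d = c"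
      proof cases
        case 1
        then show ?thesis
          using cQ by (intro exI[of _ cQ]) (simp add: cntR cntQ noP generic_dir_minus)
      next
        case 2
        then show ?thesis
          using cP by (intro exI[of _ cP]) (simp add: cntR cntP noQ generic_dir_minus)
      next
        case 3
        have "p u d \<or> q u d" if "generic_dir R d" "d \<bullet> u = 0" for d
          using 3 that aP[OF that(1) u0] aQ[OF that(1) u0] by (auto simp: orth_plane_def inner_commute)
        \<comment> \<open>The union contains every generic \<open>d\<close> together with
          \<open>- d\<close>, which gives the value 2.\<close>
        then show ?thesis by (intro exI[of _ 2]) (simp add: cntR generic_dir_minus)
      next
        case 4
        then have "q u d \<longleftrightarrow> p u d" if "generic_dir R d" for d
          using aP[OF that u0] aQ[OF that u0] by blast
        then show ?thesis
          using cP by (intro exI[of _ cP]) (simp add: cntR cntP generic_dir_minus)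
      next
        case 5
        have "p u d \<longleftrightarrow> q u (- d)" if "generic_dir R d" for d
        proof -
          have "d \<in> uminus ` aggregated_cone Q u \<longleftrightarrow> - d \<in> aggregated_cone Q u"
            by (metis (no_types, lifting) image_iff minus_minus)
          then show ?thesis using 5 aP[OF that u0] aQ[OF generic_dir_minus[OF that] u0] by blast
        qed
        from this this[OF generic_dir_minus]
        have "p u d \<longleftrightarrow> q u (- d)" "q u d \<longleftrightarrow> p u (- d)" if "generic_dir R d" for d
          using that by auto
        \<comment> \<open>The union of a cone and its negative is symmetric: its count is 2 as soon
          as \<open>P\<close> has one of \<open>d\<close> and \<open>- d\<close>, and 0
          otherwise.\<close>
        then have "segment_count R u d = (if segment_count P u d = 0 then 0 else 2)" if "generic_dir R d" for d
          unfolding cntR[OF that] cntP using that by (cases "p u d"; cases "p u (- d)") simp_all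
        then have "segment_count R u d = (if cP = 0 then 0 else 2)" if "generic_dir R d" "d \<bullet> u = 0" for d
          using cP that by simp
        then show ?thesis by blast
      qed
      then show "\<exists>c. \<forall>d. generic_dir R d \<and> d \<bullet> u = 0 \<longrightarrow> segment_count R u d = c" by blast
    qed
  qed
qed

end
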